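(* Let $p$ be an odd prime, $n\ge2$, let $\eta$ be a quadratic character of $(\mathbb Z/p^n\mathbb Z)^\times$ (i.e. $\eta$ is trivial or $\eta=\left(\frac{\cdot}{p}\right)$), extended to a genuine character of $\overline{K_n}$, and let $\lambda\in\mathbb Z_p^\times$ be a nonsquare modulo $p$. Then each of the double cosets $\overline{K_n}\,\tilde g\,\overline{K_n}$ with $$\tilde g\in\{(I,1),\ (w(1),1)\}\cup\{(y(p^r),1),\ (y(\lambda p^r),1):1\le r\le n-1\}$$ supports a nonzero element of $H=H(\overline K//\overline{K_n},\eta)$.
   Context: Let $G=\mathrm{SL}_2(\mathbb Q_p)$, $K=\mathrm{SL}_2(\mathbb Z_p)$ and $K_n=K_0(p^n)=\{\begin{pmatrix}a&b\\ c&d\end{pmatrix}\in K: c\in p^n\mathbb Z_p\}$. $(\cdot,\cdot)_p$ is the quadratic Hilbert symbol of $\mathbb Q_p$. For $A=\begin{pmatrix}a&b\\ c&d\end{pmatrix}$ put $\tau(A)=c$ if $c\neq0$ and $\tau(A)=d$ if $c=0$; for $g\in G$ put $s_p(g)=(c,d)_p$ if $cd\ne0$ and $\mathrm{ord}_p(c)$ is odd, and $s_p(g)=1$ otherwise. Put $\sigma_0(g,h)=(\tau(gh)\tau(g),\tau(gh)\tau(h))_p$ and $c(g,h)=\sigma_0(g,h)s_p(g)s_p(h)s_p(gh)$. The metaplectic double cover $\widetilde G$ is $G\times\{\pm1\}$ with $(g,\epsilon_1)(h,\epsilon_2)=(gh,\epsilon_1\epsilon_2c(g,h))$; $\overline S$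 denotes the full inverse image of a subgroup $S\subset G$. For odd $p$ the cover splits over $K$ by $k\mapsto(k,1)$. $\eta$ is viewed as the character $\begin{pmatrix}a&b\\ c&d\end{pmatrix}\mapsto\eta(d)$ of $K_n$, and as the genuine character $\eta((A,\epsilon))=\epsilon\,\eta(A)$ of $\overline{K_n}$. $H(\overline K//\overline{K_n},\eta)$ is the space of $f\in C_c^\infty(\widetilde G)$ supported on $\overline K$ with $f(\tilde k\tilde g\tilde k')=\overline{\eta}(\tilde k)\overline{\eta}(\tilde k')f(\tilde g)$ for $\tilde k,\tilde k'\in\overline{K_n}$, $\tilde g\in\widetilde G$. Notation: $y(s)=\begin{pmatrix}1&0\\ s&1\end{pmatrix}$, $w(t)=\begin{pmatrix}0&t\\ -t^{-1}&0\end{pmatrix}$. *)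

theory Defs
  imports
    "HOL-Analysis.Analysis"
    "HOL-Algebra.Coset"
    "HOL-Number_Theory.Residues"
    "HOL-Computational_Algebra.Polynomial_Factorial"
    "Berlekamp_Zassenhaus.Finite_Field"
begin

text \<open>
  The prime \<open>p\<close> is \<open>CARD('p)\<close> for a type \<open>'p\<close> of class \<^class>\<open>prime_card\<close>.  The ring of
  \<open>p\<close>-adic integers is the inverse limit of the rings \<open>\<int>/p\<^sup>n\<int>\<close>, an element being the sequence of its
  least nonnegative residues (the defining equation forces \<open>0 \<le> x n < p\<^sup>n\<close>); the field of
  \<open>p\<close>-adic numbers is its field of fractions.
\<close>

typedef ('p::prime_card) padic_int =
  "{x :: nat \<Rightarrow> int. \<forall>n. x n = x (Suc n) mod int CARD('p) ^ n}"
  by (rule exI[of _ "\<lambda>_. 0"]) simp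

setup_lifting type_definition_padic_int

lemma mod_mod_power_Suc: "a mod q ^ Suc n mod q ^ n = a mod q ^ n" for a q :: int
  by (simp add: mod_mod_cancel le_imp_power_dvd)

lemma padic_compatible_lift:
  fixes q :: int
  assumes "\<And>a b. f (a mod q ^ n) (b mod q ^ n) mod q ^ n = f a b mod q ^ n"
    and "x = x' mod q ^ n" and "y = y' mod q ^ n"
  shows "f x y mod q ^ n = f x' y' mod q ^ Suc n mod q ^ n"
  unfolding mod_mod_power_Suc assms(2,3) by (rule assms(1))

lift_definition padic_residue :: "nat \<Rightarrow> 'p::prime_card padic_int \<Rightarrow> int" is "\<lambda>n x. x n" .

lemma padic_int_eqI: "(\<And>n. padic_residue n x = padic_residue n y) \<Longrightarrow> x = y"
  by (simp add: padic_residue.rep_eq Rep_padic_int_inject[symmetric] ext)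

lemma padic_residue_Suc_mod:
  "padic_residue (Suc n) x mod int CARD('p) ^ n = padic_residue n (x :: 'p::prime_card padic_int)"
proof -
  have "\<forall>n. Rep_padic_int x n = Rep_padic_int x (Suc n) mod int CARD('p) ^ n"
    using Rep_padic_int[of x] by blast
  from spec[OF this, of n] show ?thesis
    by (simp add: padic_residue.rep_eq)
qed

lemma padic_residue_mod [simp]:
  "padic_residue n x mod int CARD('p) ^ n = padic_residue n (x :: 'p::prime_card padic_int)"
  by (metis mod_mod_trivial padic_residue_Suc_mod)

lemma padic_residue_mod_le:
  assumes "m \<le> n"
  shows "padic_residue n x mod int CARD('p) ^ m = padic_residue m (x :: 'p::prime_card padic_int)"
  using assms
proof (induction n rule: dec_induct)
  case base
  show ?case by simp
next
  case (step n)
  have "padic_residue (Suc n) x mod int CARD('p) ^ m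
      = padic_residue (Suc n) x mod int CARD('p) ^ n mod int CARD('p) ^ m"
    using step.hyps by (simp add: mod_mod_cancel le_imp_power_dvd)
  also have "\<dots> = padic_residue m x"
    using step.IH by (simp add: padic_residue_Suc_mod)
  finally show ?case .
qed

instantiation padic_int :: (prime_card) comm_ring_1
begin

lift_definition zero_padic_int :: "'a padic_int" is "\<lambda>_. 0" by simp

lift_definition one_padic_int :: "'a padic_int" is "\<lambda>n. 1 mod int CARD('a) ^ n"
  by (simp only: mod_mod_power_Suc mem_Collect_eq)

lift_definition plus_padic_int :: "'a padic_int \<Rightarrow> 'a padic_int \<Rightarrow> 'a padic_int"
  is "\<lambda>x y n. (x n + y n) mod int CARD('a) ^ n"
  by (rule padic_compatible_lift[where f = "(+)"], rule mod_add_eq, blast+)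

lift_definition minus_padic_int :: "'a padic_int \<Rightarrow> 'a padic_int \<Rightarrow> 'a padic_int"
  is "\<lambda>x y n. (x n - y n) mod int CARD('a) ^ n"
  by (rule padic_compatible_lift[where f = "(-)"], rule mod_diff_eq, blast+)

lift_definition uminus_padic_int :: "'a padic_int \<Rightarrow> 'a padic_int"
  is "\<lambda>x n. (- x n) mod int CARD('a) ^ n"
  by (rule padic_compatible_lift[where f = "\<lambda>a _. - a"], rule mod_minus_eq) blast+

lift_definition times_padic_int :: "'a padic_int \<Rightarrow> 'a padic_int \<Rightarrow> 'a padic_int"
  is "\<lambda>x y n. (x n * y n) mod int CARD('a) ^ n"
  by (rule padic_compatible_lift[where f = "(*)"], rule mod_mult_eq, blast+)

lemma padic_residue_zero: "padic_residue n (0 :: 'a padic_int) = 0"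
  by (simp add: padic_residue.rep_eq zero_padic_int.rep_eq)

lemma padic_residue_one: "padic_residue n (1 :: 'a padic_int) = 1 mod int CARD('a) ^ n"
  by (simp add: padic_residue.rep_eq one_padic_int.rep_eq)

lemma padic_residue_add:
  "padic_residue n (x + y) = (padic_residue n x + padic_residue n y) mod int CARD('a) ^ n"
  for x y :: "'a padic_int"
  by (simp add: padic_residue.rep_eq plus_padic_int.rep_eq)

lemma padic_residue_diff:
  "padic_residue n (x - y) = (padic_residue n x - padic_residue n y) mod int CARD('a) ^ n"
  for x y :: "'a padic_int"
  by (simp add: padic_residue.rep_eq minus_padic_int.rep_eq)

lemma padic_residue_minus:
  "padic_residue n (- x) = (- padic_residue n x) mod int CARD('a) ^ n"
  for x :: "'a padic_int"
  by (simp add: padic_residue.rep_eq uminus_padic_int.rep_eq)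

lemma padic_residue_mult:
  "padic_residue n (x * y) = (padic_residue n x * padic_residue n y) mod int CARD('a) ^ n"
  for x y :: "'a padic_int"
  by (simp add: padic_residue.rep_eq times_padic_int.rep_eq)

lemmas padic_residue_simps =
  padic_residue_zero padic_residue_one padic_residue_add padic_residue_diff
  padic_residue_minus padic_residue_mult

instance
proof
  fix a b c :: "'a padic_int"
  show "a * b * c = a * (b * c)"
    by (rule padic_int_eqI) (simp add: padic_residue_simps mod_simps mult.assoc)
  show "a * b = b * a"
    by (rule padic_int_eqI) (simp add: padic_residue_simps mult.commute)
  show "1 * a = a"
    by (rule padic_int_eqI) (simp add: padic_residue_simps mod_simps)
  show "a + b + c = a + (b + c)"
    by (rule padic_int_eqI) (simp add: padic_residue_simps mod_simps add.assoc)
  show "a + b = b + a"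
    by (rule padic_int_eqI) (simp add: padic_residue_simps add.commute)
  show "0 + a = a"
    by (rule padic_int_eqI) (simp add: padic_residue_simps)
  show "- a + a = 0"
    by (rule padic_int_eqI) (simp add: padic_residue_simps mod_simps)
  show "a - b = a + - b"
    by (rule padic_int_eqI) (simp add: padic_residue_simps mod_simps)
  show "(a + b) * c = a * c + b * c"
    by (rule padic_int_eqI) (simp add: padic_residue_simps mod_simps distrib_right)
  have "int CARD('a) > 1"
    using prime_card[where 'a = 'a] prime_gt_1_nat by auto
  then have "padic_residue 1 (1 :: 'a padic_int) = 1"
    by (simp add: padic_residue_one)
  then show "(0 :: 'a padic_int) \<noteq> 1"
    by (metis padic_residue_zero zero_neq_one)
qed

end

instance padic_int :: (prime_card) idom
proof
  fix a b :: "'a padic_int"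
  let ?p = "int CARD('a)"
  assume "a \<noteq> 0" "b \<noteq> 0"
  then obtain m n where mn: "padic_residue m a \<noteq> 0" "padic_residue n b \<noteq> 0"
    by (metis padic_int_eqI padic_residue_zero)
  have p: "prime_elem ?p"
    using prime_card[where 'a = 'a] by (simp add: prime_imp_prime_elem)
  show "a * b \<noteq> 0"
  proof
    assume "a * b = 0"
    then have "padic_residue (m + n) a * padic_residue (m + n) b mod ?p ^ (m + n) = 0"
      by (metis padic_residue_mult padic_residue_zero)
    then have d: "?p ^ (m + n) dvd padic_residue (m + n) a * padic_residue (m + n) b"
      by auto
    have "m \<noteq> 0" "n \<noteq> 0"
      using mn padic_residue_mod[of 0 a] padic_residue_mod[of 0 b] by (auto intro: gr0I)
    then have "Suc (m + n - 1) = m + n"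
      by simp
    moreover have "?p ^ (m + n - 1) dvd ?p ^ (m + n)"
      by (rule le_imp_power_dvd) simp
    ultimately have "?p ^ m dvd padic_residue (m + n) a \<or> ?p ^ n dvd padic_residue (m + n) b"
      using prime_elem_power_dvd_cases[OF _ _ p, of "m + n - 1" _ _ m n] d
      by (metis dvd_trans)
    then show False
      using mn padic_residue_mod_le[of m "m + n" a] padic_residue_mod_le[of n "m + n" b] by auto
  qed
qed

type_synonym 'p padic = "'p padic_int fract"

type_synonym 'p padic_mat = "'p padic ^ 2 ^ 2"

abbreviation padic_of_int :: "'p::prime_card padic_int \<Rightarrow> 'p padic"
  where "padic_of_int \<equiv> to_fract"

definition padic_ord :: "'p::prime_card padic \<Rightarrow> int" where
  "padic_ord x = (THE e. \<exists>u. u dvd 1 \<and> x = padic_of_int u * of_nat CARD('p) powi e)"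

definition hilbert_symbol :: "'p::prime_card padic \<Rightarrow> 'p padic \<Rightarrow> int" where
  "hilbert_symbol a b =
     (if \<exists>x y z. (x, y, z) \<noteq> (0, 0, 0) \<and> z\<^sup>2 = a * x\<^sup>2 + b * y\<^sup>2 then 1 else - 1)"


definition SL2_Qp :: "'p::prime_card padic_mat set" where
  "SL2_Qp = {A. det A = 1}"

definition SL2_Zp :: "'p::prime_card padic_mat set" where
  "SL2_Zp = {A \<in> SL2_Qp. \<forall>i j. A $ i $ j \<in> range padic_of_int}"

definition K0 :: "nat \<Rightarrow> 'p::prime_card padic_mat set" where
  "K0 n = {A \<in> SL2_Zp. \<exists>z. A $ 2 $ 1 = padic_of_int (of_nat CARD('p) ^ n * z)}"

definition principal_congruence :: "nat \<Rightarrow> 'p::prime_card padic_mat set" where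
  "principal_congruence m =
     {A \<in> SL2_Zp. \<forall>i j. \<exists>z. A $ i $ j - mat 1 $ i $ j = padic_of_int (of_nat CARD('p) ^ m * z)}"

definition y_mat :: "'p::prime_card padic \<Rightarrow> 'p padic_mat" where
  "y_mat s = vector [vector [1, 0], vector [s, 1]]"

definition w_mat :: "'p::prime_card padic \<Rightarrow> 'p padic_mat" where
  "w_mat t = vector [vector [0, t], vector [- inverse t, 0]]"


definition tau :: "'p::prime_card padic_mat \<Rightarrow> 'p padic" where
  "tau A = (if A $ 2 $ 1 \<noteq> 0 then A $ 2 $ 1 else A $ 2 $ 2)"

definition s_p :: "'p::prime_card padic_mat \<Rightarrow> int" where
  "s_p A = (if A $ 2 $ 1 * A $ 2 $ 2 \<noteq> 0 \<and> odd (padic_ord (A $ 2 $ 1))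
            then hilbert_symbol (A $ 2 $ 1) (A $ 2 $ 2) else 1)"

definition sigma0 :: "'p::prime_card padic_mat \<Rightarrow> 'p padic_mat \<Rightarrow> int" where
  "sigma0 g h = hilbert_symbol (tau (g ** h) * tau g) (tau (g ** h) * tau h)"

definition cocycle :: "'p::prime_card padic_mat \<Rightarrow> 'p padic_mat \<Rightarrow> int" where
  "cocycle g h = sigma0 g h * s_p g * s_p h * s_p (g ** h)"

definition preimage_cover ::
  "'p::prime_card padic_mat set \<Rightarrow> ('p padic_mat \<times> int) set" where
  "preimage_cover S = S \<times> {1, - 1}"

definition Mp :: "('p::prime_card padic_mat \<times> int) monoid" where
  "Mp = \<lparr>carrier = preimage_cover SL2_Qp,
         monoid.mult = (\<lambda>(g, e1) (h, e2). (g ** h, e1 * e2 * cocycle g h)),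
         one = (mat 1, 1)\<rparr>"

text \<open>
  The topology of the metaplectic group is the group topology for which \<open>k \<mapsto> (k, 1)\<close>
  identifies \<open>SL\<^sub>2(\<int>\<^sub>p)\<close> with an open subgroup (\<open>p\<close> odd): the left translates of the images of the
  principal congruence subgroups form a basis.  It agrees with the product topology of
  \<open>SL\<^sub>2(\<int>\<^sub>p) \<times> {1, -1}\<close> on the preimage of \<open>SL\<^sub>2(\<int>\<^sub>p)\<close>, but it is not the product topology on the
  whole of \<open>SL\<^sub>2(\<rat>\<^sub>p) \<times> {1, -1}\<close>, because the cocycle is not locally constant.
\<close>

definition Mp_open :: "('p::prime_card padic_mat \<times> int) set \<Rightarrow> bool" where
  "Mp_open U \<longleftrightarrow> U \<subseteq> carrier Mp \<and>
     (\<forall>x\<in>U. \<exists>m. \<forall>k\<in>principal_congruence m. x \<otimes>\<^bsub>Mp\<^esub> (k, 1) \<in> U)"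

definition Mp_topology :: "('p::prime_card padic_mat \<times> int) topology" where
  "Mp_topology = topology Mp_open"

lemma principal_congruence_antimono:
  assumes "m \<le> n"
  shows "principal_congruence n \<subseteq> (principal_congruence m :: 'p::prime_card padic_mat set)"
proof -
  have "(of_nat CARD('p) ^ n * z :: 'p padic_int)
      = of_nat CARD('p) ^ m * (of_nat CARD('p) ^ (n - m) * z)" for z
    using assms by (simp flip: mult.assoc power_add)
  then have "\<exists>w. x = padic_of_int (of_nat CARD('p) ^ m * w)"
    if "\<exists>z. x = padic_of_int (of_nat CARD('p) ^ n * z)" for x :: "'p padic"
    using that by metis
  then show ?thesis
    unfolding principal_congruence_def by blast
qed

lemma openin_Mp_topology:
  "openin Mp_topology = (Mp_open :: ('p::prime_card padic_mat \<times> int) set \<Rightarrow> bool)"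
proof -
  have "istopology (Mp_open :: ('p padic_mat \<times> int) set \<Rightarrow> bool)"
    unfolding istopology_def
  proof (intro conjI allI impI)
    fix S T :: "('p padic_mat \<times> int) set"
    assume S: "Mp_open S" and T: "Mp_open T"
    show "Mp_open (S \<inter> T)"
      unfolding Mp_open_def
    proof (intro conjI ballI)
      show "S \<inter> T \<subseteq> carrier Mp"
        using S by (auto simp: Mp_open_def)
      fix x assume "x \<in> S \<inter> T"
      then obtain m n where
        "\<forall>k\<in>principal_congruence m. x \<otimes>\<^bsub>Mp\<^esub> (k, 1) \<in> S"
        "\<forall>k\<in>principal_congruence n. x \<otimes>\<^bsub>Mp\<^esub> (k, 1) \<in> T"
        using S T unfolding Mp_open_def by blast
      then show "\<exists>m. \<forall>k\<in>principal_congruence m. x \<otimes>\<^bsub>Mp\<^esub> (k, 1) \<in> S \<inter> T"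
        using principal_congruence_antimono[of m "max m n"]
          principal_congruence_antimono[of n "max m n"]
        by (intro exI[of _ "max m n"]) auto
    qed
  next
    fix \<K> :: "('p padic_mat \<times> int) set set"
    assume "\<forall>S\<in>\<K>. Mp_open S"
    then show "Mp_open (\<Union>\<K>)"
      unfolding Mp_open_def by fast
  qed
  then show ?thesis
    by (simp add: Mp_topology_def topology_inverse')
qed

definition Cc_infinity :: "('p::prime_card padic_mat \<times> int \<Rightarrow> complex) set" where
  "Cc_infinity = {f. continuous_map Mp_topology (discrete_topology UNIV) f \<and>
     compactin Mp_topology (Abstract_Topology.closure_of Mp_topology {x \<in> carrier Mp. f x \<noteq> 0})}"


definition complex_units :: "complex monoid" where
  "complex_units = \<lparr>carrier = - {0}, monoid.mult = (*), one = 1\<rparr>"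

definition quadratic_character :: "int \<Rightarrow> (int \<Rightarrow> complex) \<Rightarrow> bool" where
  "quadratic_character m \<eta> \<longleftrightarrow>
     \<eta> \<in> hom (units_of (residue_ring m)) complex_units \<and>
     (\<forall>a \<in> carrier (units_of (residue_ring m)). (\<eta> a)\<^sup>2 = 1)"

definition K0_char :: "nat \<Rightarrow> (int \<Rightarrow> complex) \<Rightarrow> 'p::prime_card padic_mat \<Rightarrow> complex" where
  "K0_char n \<eta> A = \<eta> (padic_residue n (the_inv padic_of_int (A $ 2 $ 2)))"

definition genuine_char ::
  "nat \<Rightarrow> (int \<Rightarrow> complex) \<Rightarrow> 'p::prime_card padic_mat \<times> int \<Rightarrow> complex" where
  "genuine_char n \<eta> = (\<lambda>(A, e). of_int e * K0_char n \<eta> A)"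

definition Hecke_K :: "nat \<Rightarrow> (int \<Rightarrow> complex) \<Rightarrow> ('p::prime_card padic_mat \<times> int \<Rightarrow> complex) set" where
  "Hecke_K n \<eta> = {f \<in> Cc_infinity.
     {x. f x \<noteq> 0} \<subseteq> preimage_cover SL2_Zp \<and>
     (\<forall>k \<in> preimage_cover (K0 n). \<forall>k' \<in> preimage_cover (K0 n). \<forall>g \<in> carrier Mp.
        f (k \<otimes>\<^bsub>Mp\<^esub> g \<otimes>\<^bsub>Mp\<^esub> k') = cnj (genuine_char n \<eta> k) * cnj (genuine_char n \<eta> k') * f g)}"

definition K0_double_coset ::
  "nat \<Rightarrow> 'p::prime_card padic_mat \<times> int \<Rightarrow> ('p padic_mat \<times> int) set" where
  "K0_double_coset n g = (preimage_cover (K0 n) #>\<^bsub>Mp\<^esub> g) <#>\<^bsub>Mp\<^esub> preimage_cover (K0 n)"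

end

theory Submission
  imports Defs "HOL-Number_Theory.Euler_Criterion"
begin

text \<open>
  For odd \<open>p\<close> the Hilbert symbol is tame, which gives \<open>c(g, h) = 1\<close> for all \<open>g, h \<in> K\<close>: the identity to
  be checked only involves the orders and leading coefficients of the lower left entries of \<open>g\<close>, \<open>h\<close>
  and \<open>gh\<close>, and these are linked by the ultrametric inequality.  A genuine function on the preimage
  of \<open>K\<close> is therefore \<open>(A, \<epsilon>) \<mapsto> \<epsilon> \<theta>(A)\<close> for a function \<open>\<theta>\<close> on \<open>K\<close>.  Since \<open>\<eta>\<^sup>2 = 1\<close> and \<open>p\<close> is odd, \<open>\<eta>\<close>
  only depends on residues modulo \<open>p\<close>.  Hence on \<open>K\<^sub>n y(s) K\<^sub>n\<close> with \<open>p\<close> dividing \<open>s\<close> (the case \<open>s = 0\<close> being that of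
  the identity) the lower right entry \<open>d\<close> is multiplicative modulo \<open>p\<close> and \<open>\<theta>(A) = \<eta>(d)\<close> has the
  required equivariance; on \<open>K\<^sub>n w(1) K\<^sub>n\<close> the lower left entry \<open>c\<close> is a unit and \<open>\<theta>(A) = \<eta>(c)\<close> works.
\<close>

section \<open>The ring of p-adic integers\<close>

text \<open>Transporting a prescribed value from g to its whole double coset would require the two
  characters to agree on the stabiliser of g. Reading \<theta> off a matrix entry makes it well
  defined from the outset and leaves only multiplicativity of that entry to check. On the coset of
  y(p^r) the lower left entries are divisible by p^r, so d is multiplicative modulo p^r; even for r
  = 1 this suffices once \<eta> factors through residues modulo p, which is what \<eta>^2 = 1
  provides. The obstacle is the cocycle: its symbols depend on the orders of entries of g, h and gh,
  and \<open>tau\<close> switches to the lower right entry as soon as the lower left one vanishes.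
  Both force a case analysis. Oddness of p enters in three ways: units congruent to 1 modulo p are
  squares, the two signs are distinct modulo p, and a sign character is trivial on 1 + p Z_p.
  Inverses and square roots are limits of explicit powers, because u ^ (p ^ n) tends to 1 whenever u
  is 1 modulo p.\<close>

abbreviation uniformizer :: "'p::prime_card padic_int" ("\<pi>") where
  "\<pi> \<equiv> of_nat CARD('p)"

section \<open>Residues, limits and divisibility by powers of p\<close>

lemma prime_int_CARD: "prime (int CARD('p::prime_card))"
  using prime_card[where 'a = 'p] by simp

lemma int_CARD_gt_1: "int CARD('p::prime_card) > 1"
  using prime_int_CARD[where 'p = 'p] by (rule prime_gt_1_int)

lemma padic_residue_of_nat:
  "padic_residue n (of_nat k :: 'p::prime_card padic_int) = int k mod int CARD('p) ^ n"
  by (induction k) (simp_all add: padic_residue_simps mod_simps)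

lemma padic_residue_of_int:
  "padic_residue n (of_int k :: 'p::prime_card padic_int) = k mod int CARD('p) ^ n"
  by (cases k rule: int_cases2) (simp_all add: padic_residue_simps padic_residue_of_nat mod_simps)

text \<open>Completeness: the n-th term needs to be right only modulo p^n, because the diagonal
  residues already form a compatible system.\<close>

lemma padic_limit:
  fixes x :: "nat \<Rightarrow> 'p::prime_card padic_int"
  assumes "\<And>n. padic_residue n (x (Suc n)) = padic_residue n (x n)"
  obtains a :: "'p padic_int" where "\<And>n. padic_residue n a = padic_residue n (x n)"
proof
  let ?s = "\<lambda>n. padic_residue n (x n)"
  have "?s \<in> {s. \<forall>n. s n = s (Suc n) mod int CARD('p) ^ n}"
    using assms by (simp add: padic_residue_Suc_mod)
  from fun_cong[OF Abs_padic_int_inverse[OF this]]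
  show "padic_residue n (Abs_padic_int ?s :: 'p padic_int) = ?s n" for n
    unfolding padic_residue.rep_eq[of n "Abs_padic_int ?s"] .
qed

lemma padic_power_dvd_iff:
  "\<pi> ^ n dvd x \<longleftrightarrow> padic_residue n x = 0" for x :: "'p::prime_card padic_int"
proof
  assume "\<pi> ^ n dvd x"
  then obtain z where "x = \<pi> ^ n * z" ..
  moreover have "padic_residue n (\<pi> ^ n :: 'p padic_int) = 0"
    using padic_residue_of_nat[where k = "CARD('p) ^ n" and n = n and 'p = 'p] by simp
  ultimately show "padic_residue n x = 0"
    by (simp add: padic_residue_mult)
next
  let ?q = "int CARD('p)"
  assume x: "padic_residue n x = 0"
  \<comment> \<open>Dividing by p^n costs n digits, so the k-th residue of the quotient is taken
    from level n + k.\<close>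
  define z where "z k = padic_residue (n + k) x div ?q ^ n" for k
  have div: "padic_residue (n + k) x = ?q ^ n * z k" for k
    using padic_residue_mod_le[of n "n + k" x] x unfolding z_def
    by (metis dvd_eq_mod_eq_0 dvd_mult_div_cancel le_add1)
  have step: "padic_residue k (of_int (z (Suc k)) :: 'p padic_int) 
      = padic_residue k (of_int (z k) :: 'p padic_int)" for k
  proof -
    have "?q ^ n * z (Suc k) mod (?q ^ n * ?q ^ k) = ?q ^ n * z k"
      using padic_residue_mod_le[of "n + k" "n + Suc k" x] div[of k] div[of "Suc k"]
      by (simp add: power_add)
    then have "z (Suc k) mod ?q ^ k = z k"
      by (simp add: mod_mult_mult1)
    moreover from this have "z k mod ?q ^ k = z k"
      by (metis mod_mod_trivial)
    ultimately show ?thesis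
      by (simp add: padic_residue_of_int)
  qed
  obtain a :: "'p padic_int" where a: "\<And>k. padic_residue k a = padic_residue k (of_int (z k) :: 'p padic_int)"
    by (rule padic_limit[OF step]) (rule that)
  have "x = \<pi> ^ n * a"
  proof (rule padic_int_eqI)
    fix k
    have "padic_residue k (\<pi> ^ n * a) = ?q ^ n mod ?q ^ k * (z k mod ?q ^ k) mod ?q ^ k"
      using padic_residue_of_nat[where k = "CARD('p) ^ n" and n = k and 'p = 'p]
      by (simp add: padic_residue_mult a padic_residue_of_int)
    also have "\<dots> = padic_residue (n + k) x mod ?q ^ k"
      by (simp add: div mod_simps)
    finally show "padic_residue k x = padic_residue k (\<pi> ^ n * a)"
      by (simp add: padic_residue_mod_le)
  qed
  then show "\<pi> ^ n dvd x" by simp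
qed

lemma padic_dvd_iff: "\<pi> dvd x \<longleftrightarrow> padic_residue 1 x = 0" for x :: "'p::prime_card padic_int"
  using padic_power_dvd_iff[of 1 x] by simp

lemma padic_residue_eq_iff:
  "padic_residue n x = padic_residue n y \<longleftrightarrow> \<pi> ^ n dvd x - y" for x y :: "'p::prime_card padic_int"
proof -
  have "\<pi> ^ n dvd x - y \<longleftrightarrow> padic_residue n x mod int CARD('p) ^ n = padic_residue n y mod int CARD('p) ^ n"
    unfolding padic_power_dvd_iff padic_residue_diff mod_eq_dvd_iff by (simp add: dvd_eq_mod_eq_0)
  then show ?thesis by simp
qed

lemma padic_residue_range:
  "padic_residue n x \<in> {0..<int CARD('p) ^ n}" for x :: "'p::prime_card padic_int"
  using padic_residue_mod[of n x] int_CARD_gt_1[where 'p = 'p]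
  by (metis atLeastLessThan_iff pos_mod_bound pos_mod_sign zero_less_power less_trans zero_less_one)

text \<open>Divisibility by p is decided by the residue modulo p, so primality of p carries over
  from the integers.\<close>

lemma uniformizer_dvd_mult:
  "\<pi> dvd x * y \<longleftrightarrow> \<pi> dvd x \<or> \<pi> dvd y" for x y :: "'p::prime_card padic_int"
proof -
  have *: "int CARD('p) dvd padic_residue 1 z \<longleftrightarrow> padic_residue 1 z = 0" for z :: "'p padic_int"
    using padic_residue_mod[of 1 z] by (simp add: dvd_eq_mod_eq_0)
  have "\<pi> dvd x * y \<longleftrightarrow> int CARD('p) dvd padic_residue 1 x * padic_residue 1 y"
    unfolding padic_dvd_iff padic_residue_mult by (simp add: dvd_eq_mod_eq_0)
  then show ?thesis
    using prime_int_CARD[where 'p = 'p] by (simp add: prime_dvd_mult_iff padic_dvd_iff * del: One_nat_def)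
qed

lemma uniformizer_not_unit: "\<not> \<pi> dvd (1 :: 'p::prime_card padic_int)"
  using int_CARD_gt_1[where 'p = 'p] by (simp add: padic_dvd_iff padic_residue_one)

lemma uniformizer_nonzero [simp]: "(\<pi> :: 'p::prime_card padic_int) \<noteq> 0"
proof
  assume "(\<pi> :: 'p padic_int) = 0"
  then have "int CARD('p) mod int CARD('p) ^ 2 = 0"
    using padic_residue_of_nat[where k = "CARD('p)" and n = 2 and 'p = 'p]
    by (simp add: padic_residue_zero)
  then show False
    using int_CARD_gt_1[where 'p = 'p] zdvd_not_zless[of "int CARD('p)" "int CARD('p) ^ 2"]
    by (simp add: power2_eq_square dvd_eq_mod_eq_0[symmetric])
qed

section \<open>Powers of units, inverses, and extraction of powers of p\<close>

lemma uniformizer_dvd_diff_cong: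
  "\<pi> dvd x - y \<Longrightarrow> \<pi> dvd x \<longleftrightarrow> \<pi> dvd y" for x y :: "'p::prime_card padic_int"
  by (metis diff_add_cancel dvd_add_right_iff)

text \<open>In v^p - 1 = (v - 1)(1 + v + ... + v^(p-1)) with v congruent to 1, the second factor is
  congruent to p, hence to 0, modulo p. So each p-th power gains a factor p.\<close>

lemma padic_power_one_plus:
  fixes u :: "'p::prime_card padic_int"
  assumes "\<pi> dvd u - 1"
  shows "\<pi> ^ Suc n dvd u ^ (CARD('p) ^ n) - 1"
proof (induction n)
  case 0
  then show ?case using assms by simp
next
  case (Suc n)
  let ?v = "u ^ (CARD('p) ^ n)"
  have v: "\<pi> dvd ?v - 1"
    using Suc dvd_trans[of \<pi> "\<pi> ^ Suc n"] by simp
  have "\<pi> dvd (\<Sum>i<CARD('p). ?v ^ i - 1)"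
    by (rule dvd_sum) (metis v dvd_mult2 power_diff_1_eq)
  then have "\<pi> dvd (\<Sum>i<CARD('p). ?v ^ i) - \<pi>"
    by (simp add: sum_subtractf)
  then have "\<pi> dvd (\<Sum>i<CARD('p). ?v ^ i)"
    using uniformizer_dvd_diff_cong[of "\<Sum>i<CARD('p). ?v ^ i" \<pi>] by simp
  with Suc have "\<pi> ^ Suc n * \<pi> dvd (?v - 1) * (\<Sum>i<CARD('p). ?v ^ i)"
    by (rule mult_dvd_mono)
  also have "\<dots> = ?v ^ CARD('p) - 1"
    by (rule power_diff_1_eq[symmetric])
  also have "?v ^ CARD('p) = u ^ (CARD('p) ^ Suc n)"
    by (simp flip: power_mult add: mult.commute)
  finally show ?case
    by (simp add: mult.commute)
qed

lemma padic_residue_power: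
  fixes x :: "'p::prime_card padic_int"
  shows "padic_residue n (x ^ k) = padic_residue n x ^ k mod int CARD('p) ^ n"
  by (induction k) (simp_all add: padic_residue_simps mod_simps)

lemma padic_fermat:
  fixes u :: "'p::prime_card padic_int"
  assumes "\<not> \<pi> dvd u"
  shows "\<pi> dvd u ^ (CARD('p) - 1) - 1"
proof -
  define r where "r = nat (padic_residue 1 u)"
  have r: "padic_residue 1 u = int r" 
    using padic_residue_range[of 1 u] by (simp add: r_def)
  have "\<not> CARD('p) dvd r"
    using assms padic_residue_range[of 1 u] by (auto simp: padic_dvd_iff r simp del: One_nat_def dest: dvd_imp_le)
  then have "[r ^ (CARD('p) - 1) = 1] (mod CARD('p))"
    using fermat_theorem prime_card by blast
  then have "int r ^ (CARD('p) - 1) mod int CARD('p) = 1 mod int CARD('p)"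
    by (metis cong_def cong_int_iff of_nat_1 of_nat_power)
  then have "padic_residue 1 (u ^ (CARD('p) - 1)) = padic_residue 1 (1 :: 'p padic_int)"
    by (simp add: padic_residue_power r padic_residue_one del: One_nat_def)
  then show ?thesis
    by (simp add: padic_residue_eq_iff del: One_nat_def)
qed

lemma padic_unit_iff: "u dvd 1 \<longleftrightarrow> \<not> \<pi> dvd u" for u :: "'p::prime_card padic_int"
proof
  assume "u dvd 1"
  then show "\<not> \<pi> dvd u"
    using uniformizer_not_unit dvd_trans by blast
next
  assume u: "\<not> \<pi> dvd u"
  let ?p = "CARD('p)"
  have p1: "?p > 1"
    using int_CARD_gt_1[where 'p = 'p] by simp
  have pow: "\<pi> ^ Suc n dvd u ^ ((?p - 1) * ?p ^ n) - 1" for n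
    using padic_power_one_plus[OF padic_fermat[OF u]] by (simp add: power_mult)
  \<comment> \<open>As u ^ ((p - 1) * p^n) tends to 1, lowering the exponent by one gives
    approximate inverses of u.\<close>
  define x where "x n = u ^ ((?p - 1) * ?p ^ n - 1)" for n
  have ux: "u * x n = u ^ ((?p - 1) * ?p ^ n)" for n
    using p1 unfolding x_def by (simp flip: power_Suc)
  have "\<pi> ^ n dvd u * (x (Suc n) - x n)" for n
  proof -
    have "\<pi> ^ n dvd u ^ ((?p - 1) * ?p ^ m) - 1" if "n \<le> Suc m" for m
      using pow[of m] le_imp_power_dvd[OF that, of \<pi>] dvd_trans by blast
    from dvd_diff[OF this[of "Suc n"] this[of n]]
    have "\<pi> ^ n dvd (u ^ ((?p - 1) * ?p ^ Suc n) - 1) - (u ^ ((?p - 1) * ?p ^ n) - 1)"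
      by simp
    then show ?thesis
      by (simp add: right_diff_distrib ux)
  qed
  \<comment> \<open>The factor u cannot be cancelled yet, so it is neutralised by its approximate
    inverse \<open>x n\<close>.\<close>
  then have "\<pi> ^ n dvd x n * (u * (x (Suc n) - x n))" for n
    by (rule dvd_mult)
  then have "\<pi> ^ n dvd (u * x n - 1) * (x (Suc n) - x n) + (x (Suc n) - x n)" for n
    by (simp add: algebra_simps)
  moreover have ux1: "\<pi> ^ n dvd u * x n - 1" for n
    unfolding ux using pow[of n] le_imp_power_dvd[of n "Suc n" \<pi>] dvd_trans by auto
  then have "\<pi> ^ n dvd (u * x n - 1) * (x (Suc n) - x n)" for n
    by (rule dvd_mult2)
  ultimately have "\<pi> ^ n dvd x (Suc n) - x n" for n
    using dvd_add_right_iff by blast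
  then have "padic_residue n (x (Suc n)) = padic_residue n (x n)" for n
    by (simp add: padic_residue_eq_iff)
  then obtain a :: "'p padic_int" where a: "\<And>n. padic_residue n a = padic_residue n (x n)"
    by (rule padic_limit) (rule that)
  have "u * a = 1"
  proof (rule padic_int_eqI)
    fix n
    have "padic_residue n (u * x n) = padic_residue n (1 :: 'p padic_int)"
      using ux1 by (simp add: padic_residue_eq_iff)
    then show "padic_residue n (u * a) = padic_residue n (1 :: 'p padic_int)"
      by (simp add: padic_residue_mult a)
  qed
  then show "u dvd 1"
    by (metis dvd_triv_left)
qed

lemma padic_nonzero_not_dvd:
  fixes x :: "'p::prime_card padic_int"
  assumes "x \<noteq> 0"
  obtains m where "\<not> \<pi> ^ m dvd x"
  using assms padic_int_eqI[of x 0] by (auto simp: padic_power_dvd_iff padic_residue_zero)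

text \<open>A bound m with p^m not dividing x exists for nonzero x and makes the extraction of
  factors p terminate.\<close>

lemma padic_decompose:
  fixes x :: "'p::prime_card padic_int"
  assumes "x \<noteq> 0"
  obtains u n where "u dvd 1" "x = u * \<pi> ^ n"
proof -
  have "\<exists>u n. u dvd 1 \<and> x = u * \<pi> ^ n" if "\<not> \<pi> ^ m dvd x" for m
    using that
  proof (induction m arbitrary: x)
    case (Suc m)
    show ?case
    proof (cases "\<pi> dvd x")
      case True
      then obtain y where y: "x = \<pi> * y" ..
      then have "\<not> \<pi> ^ m dvd y"
        using Suc.prems by auto
      then obtain u n where "u dvd 1" "y = u * \<pi> ^ n"
        using Suc.IH by blast
      then show ?thesis
        using y by (intro exI[of _ u] exI[of _ "Suc n"]) (simp add: mult_ac)
    next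
      case False
      then show ?thesis
        by (intro exI[of _ x] exI[of _ 0]) (simp add: padic_unit_iff)
    qed
  qed simp
  moreover obtain m where "\<not> \<pi> ^ m dvd x"
    using padic_nonzero_not_dvd[OF assms] .
  ultimately show ?thesis
    using that by blast
qed

section \<open>Square roots of units\<close>

lemma padic_sqrt_one_plus:
  fixes u :: "'p::prime_card padic_int"
  assumes "odd CARD('p)" and "\<pi> dvd u - 1"
  obtains w where "u = w\<^sup>2"
proof -
  let ?p = "CARD('p)"
  have pow: "\<pi> ^ n dvd u ^ (?p ^ n) - 1" for n
    using padic_power_one_plus[OF assms(2), of n] by (metis dvd_trans le_imp_power_dvd lessI less_imp_le)
  \<comment> \<open>The square of \<open>x n\<close> is u * u ^ (p ^ n), which tends to u; the
    exponent is exact because p is odd.\<close>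
  define x where "x n = u ^ ((?p ^ n + 1) div 2)" for n
  have "\<pi> ^ n dvd x (Suc n) - x n" for n
  proof -
    obtain k where k: "?p = 2 * k + 1"
      using assms(1) by (elim oddE)
    have odd: "odd (?p ^ n)"
      using assms(1) by simp
    \<comment> \<open>The exponent grows by a multiple of p^n, so consecutive terms differ by a
      factor congruent to 1 modulo p^n.\<close>
    have "(?p ^ Suc n + 1) div 2 = (?p ^ n + 1) div 2 + ?p ^ n * k"
    proof -
      have "?p ^ Suc n = (2 * k + 1) * ?p ^ n"
        by (metis k power_Suc)
      then have "?p ^ Suc n + 1 = ?p ^ n + 1 + 2 * (?p ^ n * k)"
        by (simp only: algebra_simps)
      then show ?thesis
        by (simp only: div_mult_self2)
    qed
    then have "x (Suc n) - x n = x n * ((u ^ (?p ^ n)) ^ k - 1)"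
      by (simp add: x_def power_add power_mult right_diff_distrib)
    moreover have "\<pi> ^ n dvd (u ^ (?p ^ n)) ^ k - 1"
      by (metis pow dvd_mult2 power_diff_1_eq)
    ultimately show ?thesis
      by simp
  qed
  then have "padic_residue n (x (Suc n)) = padic_residue n (x n)" for n
    by (simp add: padic_residue_eq_iff)
  then obtain a :: "'p padic_int" where a: "\<And>n. padic_residue n a = padic_residue n (x n)"
    by (rule padic_limit) (rule that)
  have "u = a\<^sup>2"
  proof (rule padic_int_eqI)
    fix n
    have "(?p ^ n + 1) div 2 * 2 = ?p ^ n + 1"
      using assms(1) by (intro dvd_div_mult_self) simp
    then have "(x n)\<^sup>2 = u * u ^ (?p ^ n)"
      unfolding x_def power_mult[symmetric] by simp
    then have "u - (x n)\<^sup>2 = - (u * (u ^ (?p ^ n) - 1))"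
      by (simp add: algebra_simps)
    then have "\<pi> ^ n dvd u - (x n)\<^sup>2"
      using pow[of n] by simp
    then have "padic_residue n u = padic_residue n ((x n)\<^sup>2)"
      by (simp add: padic_residue_eq_iff)
    then show "padic_residue n u = padic_residue n (a\<^sup>2)"
      by (simp add: power2_eq_square padic_residue_mult a)
  qed
  then show ?thesis
    using that by blast
qed

text \<open>The quotient u / y^2 is congruent to 1 modulo p, which reduces the claim to
  \<open>padic_sqrt_one_plus\<close>.\<close>

lemma padic_hensel_square:
  fixes u y :: "'p::prime_card padic_int"
  assumes "odd CARD('p)" and "u dvd 1" and "\<pi> dvd u - y\<^sup>2"
  obtains w where "u = w\<^sup>2"
proof -
  have "\<not> \<pi> dvd y"
    using assms(2) uniformizer_dvd_diff_cong[OF assms(3)]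
    by (simp add: padic_unit_iff power2_eq_square uniformizer_dvd_mult)
  then obtain z where z: "y * z = 1"
    by (metis padic_unit_iff dvdE)
  have "u * z\<^sup>2 - 1 = (u - y\<^sup>2) * z\<^sup>2"
    using z by (simp add: algebra_simps flip: power_mult_distrib)
  then have "\<pi> dvd u * z\<^sup>2 - 1"
    using assms(3) by simp
  then obtain w where "u * z\<^sup>2 = w\<^sup>2"
    using padic_sqrt_one_plus[OF assms(1)] by blast
  then have "u * (y * z)\<^sup>2 = (w * y)\<^sup>2"
    by (simp add: power_mult_distrib mult_ac)
  then show ?thesis
    using that z by simp
qed

section \<open>The tame Hilbert symbol\<close>

definition padic_legendre :: "'p::prime_card padic_int \<Rightarrow> int" where
  "padic_legendre u = Legendre (padic_residue 1 u) (int CARD('p))"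

lemma padic_legendre_cong:
  "\<pi> dvd u - v \<Longrightarrow> padic_legendre u = padic_legendre v" for u v :: "'p::prime_card padic_int"
  using padic_residue_eq_iff[of 1 u v] by (simp add: padic_legendre_def)

lemma padic_residue_cong_0_iff:
  "[padic_residue 1 u = 0] (mod int CARD('p)) \<longleftrightarrow> \<pi> dvd u" for u :: "'p::prime_card padic_int"
  using padic_residue_mod[of 1 u] by (simp add: cong_def padic_dvd_iff)

lemma padic_legendre_unit:
  "u dvd 1 \<Longrightarrow> padic_legendre u = 1 \<or> padic_legendre u = - 1" for u :: "'p::prime_card padic_int"
  by (simp add: padic_legendre_def Legendre_def padic_residue_cong_0_iff padic_unit_iff del: One_nat_def)

text \<open>Euler's criterion makes both sides congruent modulo p; being signs, they are equal
  because p does not divide 2.\<close>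

lemma padic_legendre_mult:
  fixes u v :: "'p::prime_card padic_int"
  assumes p: "odd CARD('p)" and u: "u dvd 1" and v: "v dvd 1"
  shows "padic_legendre (u * v) = padic_legendre u * padic_legendre v"
proof -
  let ?p = "int CARD('p)" and ?e = "(CARD('p) - 1) div 2"
  have p2: "CARD('p) > 2"
    using prime_ge_2_nat[OF prime_card[where 'a = 'p]] p by (cases "CARD('p) = 2") auto
  have crit: "[padic_legendre w = padic_residue 1 w ^ ?e] (mod ?p)" if "w dvd 1" for w :: "'p padic_int"
    unfolding padic_legendre_def using that p2 prime_card[where 'a = 'p]
    by (intro euler_criterion) (simp_all add: padic_residue_cong_0_iff padic_unit_iff del: One_nat_def)
  have uv: "u * v dvd 1"
    using mult_dvd_mono[OF u v] by simp
  have "[padic_residue 1 (u * v) = padic_residue 1 u * padic_residue 1 v] (mod ?p)"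
    by (simp add: cong_def padic_residue_mult)
  from cong_pow[OF this, of ?e]
  have "[padic_residue 1 (u * v) ^ ?e = padic_residue 1 u ^ ?e * padic_residue 1 v ^ ?e] (mod ?p)"
    by (simp only: power_mult_distrib)
  with crit[OF uv] cong_mult[OF crit[OF u] crit[OF v]]
  have "[padic_legendre (u * v) = padic_legendre u * padic_legendre v] (mod ?p)"
    using cong_sym cong_trans by blast
  then have "?p dvd padic_legendre (u * v) - padic_legendre u * padic_legendre v"
    by (simp add: cong_iff_dvd_diff)
  moreover have "\<not> ?p dvd 2"
    using p2 zdvd_imp_le[of ?p 2] by linarith
  ultimately show ?thesis
    using padic_legendre_unit[OF u] padic_legendre_unit[OF v] padic_legendre_unit[OF uv] by auto
qed

lemma padic_legendre_square_cong:
  fixes u y :: "'p::prime_card padic_int"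
  assumes "u dvd 1" and "\<pi> dvd u - y\<^sup>2"
  shows "padic_legendre u = 1"
proof -
  have "padic_residue 1 u = padic_residue 1 (y\<^sup>2)"
    using assms(2) by (simp add: padic_residue_eq_iff)
  then have "[(padic_residue 1 y)\<^sup>2 = padic_residue 1 u] (mod int CARD('p))"
    by (simp add: cong_def padic_residue_power)
  then show ?thesis
    using assms(1)
    by (auto simp: padic_legendre_def Legendre_def QuadRes_def padic_residue_cong_0_iff padic_unit_iff
        simp del: One_nat_def)
qed

lemma padic_legendre_square: "u dvd 1 \<Longrightarrow> padic_legendre (u\<^sup>2) = 1" for u :: "'p::prime_card padic_int"
  by (rule padic_legendre_square_cong[of _ u]) (simp_all add: padic_unit_iff power2_eq_square uniformizer_dvd_mult)

lemma padic_legendre_one: "padic_legendre (1 :: 'p::prime_card padic_int) = 1"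
  using padic_legendre_square[of "1 :: 'p padic_int"] by simp

lemma padic_legendre_eq_1D:
  fixes u :: "'p::prime_card padic_int"
  assumes "odd CARD('p)" and "u dvd 1" and "padic_legendre u = 1"
  obtains w where "u = w\<^sup>2"
proof -
  have "QuadRes (int CARD('p)) (padic_residue 1 u)"
    using assms(3) by (auto simp: padic_legendre_def Legendre_def split: if_splits)
  then obtain y where y: "[y\<^sup>2 = padic_residue 1 u] (mod int CARD('p))"
    unfolding QuadRes_def by blast
  have "padic_residue 1 u = padic_residue 1 ((of_int y)\<^sup>2 :: 'p padic_int)"
    using y padic_residue_mod[of 1 u] padic_residue_of_int[of 1 "y\<^sup>2", where 'p = 'p] by (simp add: cong_def)
  then have "\<pi> dvd u - (of_int y)\<^sup>2"
    using padic_residue_eq_iff[of 1 u "(of_int y)\<^sup>2"] by simp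
  with assms(1,2) show ?thesis
    using that by (rule padic_hensel_square)
qed

lemma padic_nonresidue_one_plus_square:
  fixes u :: "'p::prime_card padic_int"
  assumes p: "odd CARD('p)" and u: "padic_legendre u = - 1"
  obtains w :: "'p padic_int" where "padic_legendre (1 + w\<^sup>2) = - 1"
proof -
  \<comment> \<open>Take the least positive nonresidue \<open>k\<close>; then \<open>k - 1\<close> is a square.\<close>
  define P where "P k \<longleftrightarrow> padic_legendre (of_nat k :: 'p padic_int) = - 1" for k
  define k where "k = (LEAST k. P k)"
  define r where "r = nat (padic_residue 1 u)"
  have r: "padic_residue 1 u = int r" and rp: "r < CARD('p)"
    using padic_residue_range[of 1 u] by (simp_all add: r_def nat_less_iff)
  have "P r"
    using u rp padic_residue_of_nat[of 1 r, where 'p = 'p] unfolding P_def padic_legendre_def r by simp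
  then have Pk: "P k" and kr: "k \<le> r" and least: "\<And>m. P m \<Longrightarrow> k \<le> m"
    unfolding k_def by (auto intro: LeastI Least_le)
  have "k \<noteq> 0"
    using Pk by (auto intro!: gr0I simp: P_def padic_legendre_def Legendre_def padic_residue_zero)
  moreover have "k \<noteq> 1"
    using Pk padic_legendre_one[where 'p = 'p] by (auto simp: P_def)
  ultimately obtain m where m: "k = Suc m" "m \<noteq> 0"
    by (metis One_nat_def not0_implies_Suc)
  have "\<not> \<pi> dvd (of_nat m :: 'p padic_int)"
    using m kr rp padic_residue_of_nat[of 1 m, where 'p = 'p] by (simp add: padic_dvd_iff)
  moreover have "\<not> P m"
    using least[of m] m by auto
  ultimately have "padic_legendre (of_nat m :: 'p padic_int) = 1" and "(of_nat m :: 'p padic_int) dvd 1"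
    using padic_legendre_unit[of "of_nat m :: 'p padic_int"] by (auto simp: P_def padic_unit_iff)
  then obtain w :: "'p padic_int" where "of_nat m = w\<^sup>2"
    using padic_legendre_eq_1D[OF p] by blast
  with Pk m show ?thesis
    by (intro that[of w]) (simp add: P_def)
qed

section \<open>General properties of the Hilbert symbol and integral solutions\<close>

lemma hilbert_symbol_eq_1_iff:
  "hilbert_symbol a b = 1 \<longleftrightarrow> (\<exists>x y z. (x, y, z) \<noteq> (0, 0, 0) \<and> z\<^sup>2 = a * x\<^sup>2 + b * y\<^sup>2)"
  by (simp add: hilbert_symbol_def)

lemma hilbert_symbol_range: "hilbert_symbol a b = 1 \<or> hilbert_symbol a b = - 1"
  by (simp add: hilbert_symbol_def)

lemma hilbert_symbol_eqI:
  "(hilbert_symbol a b = 1 \<longleftrightarrow> hilbert_symbol c d = 1) \<Longrightarrow> hilbert_symbol a b = hilbert_symbol c d"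
  using hilbert_symbol_range by metis

lemma hilbert_symbol_commute: "hilbert_symbol a b = hilbert_symbol b a"
proof (rule hilbert_symbol_eqI)
  have "hilbert_symbol d c = 1" if "hilbert_symbol c d = 1" for c d :: "'a padic"
  proof -
    from that obtain x y z where "(x, y, z) \<noteq> (0, 0, 0)" "z\<^sup>2 = c * x\<^sup>2 + d * y\<^sup>2"
      unfolding hilbert_symbol_eq_1_iff by blast
    then show ?thesis
      unfolding hilbert_symbol_eq_1_iff
      by (intro exI[of _ y] exI[of _ x] exI[of _ z]) (auto simp: add.commute)
  qed
  then show "hilbert_symbol a b = 1 \<longleftrightarrow> hilbert_symbol b a = 1"
    by blast
qed

lemma hilbert_symbol_mult_square_left:
  assumes "s \<noteq> 0"
  shows "hilbert_symbol (a * s\<^sup>2) b = hilbert_symbol a b"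
proof (rule hilbert_symbol_eqI, rule iffI)
  assume "hilbert_symbol (a * s\<^sup>2) b = 1"
  then obtain x y z where "(x, y, z) \<noteq> (0, 0, 0)" "z\<^sup>2 = a * s\<^sup>2 * x\<^sup>2 + b * y\<^sup>2"
    unfolding hilbert_symbol_eq_1_iff by blast
  then show "hilbert_symbol a b = 1"
    unfolding hilbert_symbol_eq_1_iff using assms
    by (intro exI[of _ "s * x"] exI[of _ y] exI[of _ z]) (auto simp: power_mult_distrib mult.assoc)
next
  assume "hilbert_symbol a b = 1"
  then obtain x y z where "(x, y, z) \<noteq> (0, 0, 0)" "z\<^sup>2 = a * x\<^sup>2 + b * y\<^sup>2"
    unfolding hilbert_symbol_eq_1_iff by blast
  then show "hilbert_symbol (a * s\<^sup>2) b = 1"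
    unfolding hilbert_symbol_eq_1_iff using assms
    by (intro exI[of _ "x / s"] exI[of _ y] exI[of _ z]) (auto simp: power_divide)
qed

lemma hilbert_symbol_mult_square_right:
  assumes "s \<noteq> 0"
  shows "hilbert_symbol a (b * s\<^sup>2) = hilbert_symbol a b"
  using hilbert_symbol_mult_square_left[OF assms] hilbert_symbol_commute by metis

lemma to_fract_of_nat: "to_fract (of_nat n) = of_nat n"
  by (induction n) simp_all

lemma to_fract_power: "to_fract (x ^ n) = to_fract x ^ n"
  by (induction n) simp_all

lemma fract_as_quotient:
  fixes x :: "'a::idom fract"
  obtains a b where "b \<noteq> 0" "x = to_fract a / to_fract b"
  by (cases x) (auto simp: Fract_conv_to_fract)

text \<open>A zero over the field becomes integral after scaling by the product of the denominators.
  Common factors p are then divided out, which stops because some p^m fails to divide all three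
  coordinates. Primitivity is what makes reduction modulo p informative.\<close>

lemma hilbert_symbol_primitive_solution:
  fixes a b :: "'p::prime_card padic_int"
  assumes "hilbert_symbol (to_fract a) (to_fract b) = 1"
  obtains x y z :: "'p padic_int"
    where "\<not> (\<pi> dvd x \<and> \<pi> dvd y \<and> \<pi> dvd z)" "z\<^sup>2 = a * x\<^sup>2 + b * y\<^sup>2"
proof -
  obtain x y z :: "'p padic" where nz: "(x, y, z) \<noteq> (0, 0, 0)" and
    eq: "z\<^sup>2 = to_fract a * x\<^sup>2 + to_fract b * y\<^sup>2"
    using assms unfolding hilbert_symbol_eq_1_iff by blast
  obtain x1 x2 where x: "x2 \<noteq> 0" "x = to_fract x1 / to_fract x2" by (rule fract_as_quotient)
  obtain y1 y2 where y: "y2 \<noteq> 0" "y = to_fract y1 / to_fract y2" by (rule fract_as_quotient)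
  obtain z1 z2 where z: "z2 \<noteq> 0" "z = to_fract z1 / to_fract z2" by (rule fract_as_quotient)
  define X where "X = x1 * y2 * z2"
  define Y where "Y = x2 * y1 * z2"
  define Z where "Z = x2 * y2 * z1"
  define D where "D = x2 * y2 * z2"
  have XYZ: "to_fract X = to_fract D * x" "to_fract Y = to_fract D * y" "to_fract Z = to_fract D * z"
    using x y z by (simp_all add: X_def Y_def Z_def D_def)
  have "D \<noteq> 0"
    using x y z by (simp add: D_def)
  have "to_fract (Z\<^sup>2) = to_fract D ^ 2 * z\<^sup>2"
    by (simp only: to_fract_power XYZ power_mult_distrib)
  also have "\<dots> = to_fract (a * X\<^sup>2 + b * Y\<^sup>2)"
    by (simp add: eq to_fract_power XYZ power_mult_distrib algebra_simps)
  finally have "Z\<^sup>2 = a * X\<^sup>2 + b * Y\<^sup>2"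
    by (simp only: to_fract_eq_iff)
  moreover have "X = 0 \<longleftrightarrow> x = 0" "Y = 0 \<longleftrightarrow> y = 0" "Z = 0 \<longleftrightarrow> z = 0"
    using \<open>D \<noteq> 0\<close> XYZ by (metis mult_eq_0_iff to_fract_eq_0_iff)+
  with nz have "X \<noteq> 0 \<or> Y \<noteq> 0 \<or> Z \<noteq> 0"
    by blast
  then obtain m where "\<not> (\<pi> ^ m dvd X \<and> \<pi> ^ m dvd Y \<and> \<pi> ^ m dvd Z)"
    by (metis padic_nonzero_not_dvd)
  ultimately have "\<exists>x y z. \<not> (\<pi> dvd x \<and> \<pi> dvd y \<and> \<pi> dvd z) \<and> z\<^sup>2 = a * x\<^sup>2 + b * y\<^sup>2"
  proof (induction m arbitrary: X Y Z)
    case (Suc m)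
    show ?case
    proof (cases "\<pi> dvd X \<and> \<pi> dvd Y \<and> \<pi> dvd Z")
      case True
      then obtain X' Y' Z' where *: "X = \<pi> * X'" "Y = \<pi> * Y'" "Z = \<pi> * Z'"
        by (elim conjE dvdE) blast
      have "\<pi>\<^sup>2 * Z'\<^sup>2 = \<pi>\<^sup>2 * (a * X'\<^sup>2 + b * Y'\<^sup>2)"
        using Suc.prems(1) unfolding * power_mult_distrib by (simp add: algebra_simps)
      then have "Z'\<^sup>2 = a * X'\<^sup>2 + b * Y'\<^sup>2"
        by (subst (asm) mult_cancel_left) simp
      moreover have "\<not> (\<pi> ^ m dvd X' \<and> \<pi> ^ m dvd Y' \<and> \<pi> ^ m dvd Z')"
        using Suc.prems(2) by (auto simp: *)
      ultimately show ?thesis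
        by (rule Suc.IH)
    next
      case False
      with Suc.prems(1) show ?thesis by blast
    qed
  qed simp
  then show ?thesis
    using that by blast
qed

lemma hilbert_symbol_eq_1I:
  fixes a b x y z :: "'p::prime_card padic_int"
  assumes "z\<^sup>2 = a * x\<^sup>2 + b * y\<^sup>2" and "(x, y, z) \<noteq> (0, 0, 0)"
  shows "hilbert_symbol (to_fract a) (to_fract b) = 1"
proof -
  have "to_fract z ^ 2 = to_fract a * to_fract x ^ 2 + to_fract b * to_fract y ^ 2"
    using arg_cong[OF assms(1), of to_fract] by (simp add: to_fract_power)
  then show ?thesis
    unfolding hilbert_symbol_eq_1_iff using assms(2)
    by (intro exI[of _ "to_fract x"] exI[of _ "to_fract y"] exI[of _ "to_fract z"]) auto
qed

section \<open>Values of the Hilbert symbol for odd p\<close>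

lemma hilbert_symbol_unit_square:
  fixes u b :: "'p::prime_card padic_int"
  assumes "odd CARD('p)" "u dvd 1" "padic_legendre u = 1"
  shows "hilbert_symbol (to_fract u) (to_fract b) = 1"
proof -
  obtain w where "u = w\<^sup>2"
    using padic_legendre_eq_1D[OF assms] .
  then show ?thesis
    by (intro hilbert_symbol_eq_1I[of w _ 1 _ 0]) simp_all
qed

text \<open>If u or v is a square, a solution is evident. For two nonresidues choose a nonresidue 1
  + w^2: then u v = t^2 and u (1 + w^2) = s^2 for some t and s, and (s t)^2 = u t^2 + u w^2 t^2 = u
  t^2 + v (u w)^2.\<close>

lemma hilbert_symbol_units:
  fixes u v :: "'p::prime_card padic_int"
  assumes p: "odd CARD('p)" and u: "u dvd 1" and v: "v dvd 1"
  shows "hilbert_symbol (to_fract u) (to_fract v) = 1"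
proof (cases "padic_legendre u = 1 \<or> padic_legendre v = 1")
  case True
  then show ?thesis
    using hilbert_symbol_unit_square[OF p u] hilbert_symbol_unit_square[OF p v]
    by (metis hilbert_symbol_commute)
next
  case False
  then have nonres: "padic_legendre u = - 1" "padic_legendre v = - 1"
    using padic_legendre_unit u v by blast+
  have uv: "u * v dvd 1"
    using mult_dvd_mono[OF u v] by simp
  obtain w :: "'p padic_int" where w: "padic_legendre (1 + w\<^sup>2) = - 1"
    using padic_nonresidue_one_plus_square[OF p nonres(1)] .
  have w1: "1 + w\<^sup>2 dvd 1"
    using w padic_residue_cong_0_iff[of "1 + w\<^sup>2"]
    by (auto simp: padic_unit_iff padic_legendre_def Legendre_def split: if_splits)
  have uw: "u * (1 + w\<^sup>2) dvd 1"
    using mult_dvd_mono[OF u w1] by simp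
  obtain t where t: "u * v = t\<^sup>2"
    using padic_legendre_eq_1D[OF p uv] padic_legendre_mult[OF p u v] nonres by auto
  obtain s where s: "u * (1 + w\<^sup>2) = s\<^sup>2"
    using padic_legendre_eq_1D[OF p uw] padic_legendre_mult[OF p u w1] nonres w by auto
  have "(s * t)\<^sup>2 = u * t\<^sup>2 + u * w\<^sup>2 * t\<^sup>2"
    by (simp add: power_mult_distrib algebra_simps flip: s)
  also have "\<dots> = u * t\<^sup>2 + v * (u * w)\<^sup>2"
    by (simp add: power2_eq_square algebra_simps flip: t[unfolded power2_eq_square])
  finally show ?thesis
  proof (rule hilbert_symbol_eq_1I)
    show "(t, u * w, s * t) \<noteq> (0, 0, 0)"
      using uv t by auto
  qed
qed

text \<open>Modulo p a primitive solution reads z^2 = u x^2. If p does not divide x, then u is a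
  square residue. Otherwise p divides x and z, so p^2 divides v p y^2 and p divides y, against
  primitivity.\<close>

lemma hilbert_symbol_unit_uniformizer:
  fixes u v :: "'p::prime_card padic_int"
  assumes p: "odd CARD('p)" and u: "u dvd 1" and v: "v dvd 1"
  shows "hilbert_symbol (to_fract u) (to_fract (v * \<pi>)) = padic_legendre u"
proof (cases "padic_legendre u = 1")
  case True
  then show ?thesis
    using hilbert_symbol_unit_square[OF p u] by metis
next
  case False
  have "hilbert_symbol (to_fract u) (to_fract (v * \<pi>)) \<noteq> 1"
  proof
    assume "hilbert_symbol (to_fract u) (to_fract (v * \<pi>)) = 1"
    then obtain x y z :: "'p padic_int"
      where prim: "\<not> (\<pi> dvd x \<and> \<pi> dvd y \<and> \<pi> dvd z)" and eq: "z\<^sup>2 = u * x\<^sup>2 + v * \<pi> * y\<^sup>2"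
      by (rule hilbert_symbol_primitive_solution)
    have "\<pi> dvd x"
    proof (rule ccontr)
      assume "\<not> \<pi> dvd x"
      then obtain x' where x': "x * x' = 1"
        by (metis padic_unit_iff dvdE)
      have "u * (x * x')\<^sup>2 - (z * x')\<^sup>2 = - (\<pi> * (v * y\<^sup>2 * x'\<^sup>2))"
        by (simp add: power_mult_distrib eq algebra_simps)
      then have "\<pi> dvd u * (x * x')\<^sup>2 - (z * x')\<^sup>2"
        by simp
      then have "padic_legendre u = 1"
        using padic_legendre_square_cong[OF u, of "z * x'"] x' by simp
      with False show False ..
    qed
    moreover from this have "\<pi> dvd z\<^sup>2"
      by (simp add: eq power2_eq_square[of x])
    then have "\<pi> dvd z"
      by (simp add: power2_eq_square uniformizer_dvd_mult)
    moreover have "\<pi> dvd y"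
    proof -
      have "\<pi>\<^sup>2 dvd z\<^sup>2 - u * x\<^sup>2"
        using \<open>\<pi> dvd x\<close> \<open>\<pi> dvd z\<close> by (intro dvd_diff dvd_mult) (simp_all add: dvd_power_same)
      also have "z\<^sup>2 - u * x\<^sup>2 = \<pi> * (v * y\<^sup>2)"
        by (simp add: eq algebra_simps)
      finally have "\<pi> dvd v * y\<^sup>2"
        by (simp add: power2_eq_square)
      then show ?thesis
        using v by (simp add: power2_eq_square uniformizer_dvd_mult padic_unit_iff)
    qed
    ultimately show False
      using prim by blast
  qed
  with False padic_legendre_unit[OF u] hilbert_symbol_range show ?thesis
    by metis
qed

text \<open>If -u v = w^2, then (v, w, 0) is a zero. Conversely a primitive zero has z divisible by
  p, so u x^2 + v y^2 vanishes modulo p; if y is a unit this exhibits -u v as the square of u x / y,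
  and otherwise p divides all three coordinates.\<close>

lemma hilbert_symbol_uniformizer_uniformizer:
  fixes u v :: "'p::prime_card padic_int"
  assumes p: "odd CARD('p)" and u: "u dvd 1" and v: "v dvd 1"
  shows "hilbert_symbol (to_fract (u * \<pi>)) (to_fract (v * \<pi>)) = padic_legendre (- (u * v))"
proof -
  have uv: "- (u * v) dvd 1"
    using mult_dvd_mono[OF u v] by simp
  show ?thesis
  proof (cases "padic_legendre (- (u * v)) = 1")
    case True
    then obtain w where w: "- (u * v) = w\<^sup>2"
      using padic_legendre_eq_1D[OF p uv] by blast
    have "hilbert_symbol (to_fract (u * \<pi>)) (to_fract (v * \<pi>)) = 1"
    proof (rule hilbert_symbol_eq_1I)
      show "0\<^sup>2 = u * \<pi> * v\<^sup>2 + v * \<pi> * w\<^sup>2"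
        by (simp add: power2_eq_square algebra_simps flip: w[unfolded power2_eq_square])
      show "(v, w, 0) \<noteq> (0, 0, 0)"
        using v by auto
    qed
    with True show ?thesis by simp
  next
    case False
    have "hilbert_symbol (to_fract (u * \<pi>)) (to_fract (v * \<pi>)) \<noteq> 1"
    proof
      assume "hilbert_symbol (to_fract (u * \<pi>)) (to_fract (v * \<pi>)) = 1"
      then obtain x y z :: "'p padic_int"
        where prim: "\<not> (\<pi> dvd x \<and> \<pi> dvd y \<and> \<pi> dvd z)" and eq: "z\<^sup>2 = u * \<pi> * x\<^sup>2 + v * \<pi> * y\<^sup>2"
        by (rule hilbert_symbol_primitive_solution)
      have eq': "z\<^sup>2 = \<pi> * (u * x\<^sup>2 + v * y\<^sup>2)"
        by (simp add: eq algebra_simps)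
      then have "\<pi> dvd z\<^sup>2"
        by simp
      then have z: "\<pi> dvd z"
        by (simp add: power2_eq_square uniformizer_dvd_mult)
      then have "\<pi>\<^sup>2 dvd z\<^sup>2"
        by (simp add: dvd_power_same)
      then have dvd: "\<pi> dvd u * x\<^sup>2 + v * y\<^sup>2"
        by (simp add: eq' power2_eq_square[of \<pi>])
      have y: "\<pi> dvd y"
      proof (rule ccontr)
        assume "\<not> \<pi> dvd y"
        then obtain y' where y': "y * y' = 1"
          by (metis padic_unit_iff dvdE)
        have "- (u * v) * (y * y')\<^sup>2 - (u * x * y')\<^sup>2 = - (u * y'\<^sup>2) * (u * x\<^sup>2 + v * y\<^sup>2)"
          by (simp add: power2_eq_square algebra_simps)
        then have "\<pi> dvd - (u * v) * (y * y')\<^sup>2 - (u * x * y')\<^sup>2"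
          using dvd by simp
        then have "padic_legendre (- (u * v)) = 1"
          using padic_legendre_square_cong[OF uv, of "u * x * y'"] y' by simp
        with False show False ..
      qed
      then have "\<pi> dvd v * y\<^sup>2"
        by (simp add: power2_eq_square)
      with dvd have "\<pi> dvd u * x\<^sup>2"
        by (simp add: dvd_add_left_iff)
      then have "\<pi> dvd x"
        using u by (simp add: power2_eq_square uniformizer_dvd_mult padic_unit_iff)
      with y z prim show False
        by blast
    qed
    with False padic_legendre_unit[OF uv] hilbert_symbol_range show ?thesis
      by metis
  qed
qed

lemma power_sign_parity: "(e::int) ^ k = (if even k then 1 else e)" if "e = 1 \<or> e = - 1"
  using that by auto

text \<open>Squares drop out of either argument, so only the parities of i and j count; the three
  preceding evaluations, with symmetry, cover the four cases.\<close>

lemma hilbert_symbol_tame: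
  fixes u v :: "'p::prime_card padic_int"
  assumes p: "odd CARD('p)" and u: "u dvd 1" and v: "v dvd 1"
  shows "hilbert_symbol (to_fract (u * \<pi> ^ i)) (to_fract (v * \<pi> ^ j))
    = padic_legendre (- 1 :: 'p padic_int) ^ (i * j) * padic_legendre u ^ j * padic_legendre v ^ i"
proof -
  have split: "to_fract (w * \<pi> ^ k) = to_fract (w * \<pi> ^ (k mod 2)) * (to_fract (\<pi> ^ (k div 2)))\<^sup>2"
    for w :: "'p padic_int" and k
  proof -
    have "\<pi> ^ k = (\<pi> ^ (k mod 2) * (\<pi> ^ (k div 2))\<^sup>2 :: 'p padic_int)"
      by (simp flip: power_mult power_add)
    then show ?thesis
      by (simp add: to_fract_power mult.assoc)
  qed
  have nz: "to_fract (\<pi> ^ k :: 'p padic_int) \<noteq> 0" for k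
    by simp
  have "hilbert_symbol (to_fract (u * \<pi> ^ i)) (to_fract (v * \<pi> ^ j))
      = hilbert_symbol (to_fract (u * \<pi> ^ (i mod 2))) (to_fract (v * \<pi> ^ (j mod 2)))"
    unfolding split[of u i] split[of v j]
    by (simp only: hilbert_symbol_mult_square_left[OF nz] hilbert_symbol_mult_square_right[OF nz])
  also have "\<dots> = padic_legendre (- 1 :: 'p padic_int) ^ (i * j) * padic_legendre u ^ j * padic_legendre v ^ i"
  proof -
    have neg: "(- 1 :: 'p padic_int) dvd 1" by simp
    have "padic_legendre (- (u * v)) = padic_legendre (- 1 :: 'p padic_int) * padic_legendre u * padic_legendre v"
      using padic_legendre_mult[OF p neg, of "u * v"] padic_legendre_mult[OF p u v] mult_dvd_mono[OF u v] by simp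
    moreover have "hilbert_symbol (to_fract (u * \<pi>)) (to_fract v) = padic_legendre v"
      using hilbert_symbol_unit_uniformizer[OF p v u] by (subst hilbert_symbol_commute)
    ultimately show ?thesis
      using hilbert_symbol_units[OF p u v] hilbert_symbol_unit_uniformizer[OF p u v]
        hilbert_symbol_uniformizer_uniformizer[OF p u v]
      by (cases "even i"; cases "even j")
        (simp_all add: power_sign_parity padic_legendre_unit u v mod_2_eq_odd del: to_fract_mult)
  qed
  finally show ?thesis .
qed

section \<open>Uniqueness of the order\<close>

lemma padic_unit_power_unique:
  fixes u v :: "'p::prime_card padic_int"
  assumes "u dvd 1" "v dvd 1" "u * \<pi> ^ i = v * \<pi> ^ j"
  shows "i = j"
proof -
  have "\<not> i < j" if "u dvd 1" "u * \<pi> ^ i = v * \<pi> ^ j" for u v :: "'p padic_int" and i j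
  proof
    assume "i < j"
    then have "\<pi> ^ i * u = \<pi> ^ i * (v * \<pi> ^ (j - i))"
      using that(2) by (simp add: mult_ac flip: power_add)
    then have "u = v * \<pi> ^ (j - i)"
      by (subst (asm) mult_cancel_left) simp
    then have "\<pi> dvd u"
      using \<open>i < j\<close> by (simp add: dvd_power)
    with that(1) show False
      by (simp add: padic_unit_iff)
  qed
  from this[OF assms(1,3)] this[OF assms(2) assms(3)[symmetric]] show ?thesis
    by simp
qed

lemma padic_ord_eq:
  fixes u :: "'p::prime_card padic_int"
  assumes u: "u dvd 1"
  shows "padic_ord (to_fract (u * \<pi> ^ i)) = int i"
  unfolding padic_ord_def
proof (rule the_equality)
  show "\<exists>v. v dvd 1 \<and> to_fract (u * \<pi> ^ i) = to_fract v * of_nat CARD('p) powi int i"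
    using u by (intro exI[of _ u]) (simp add: to_fract_power to_fract_of_nat)
next
  fix e
  assume "\<exists>v. v dvd 1 \<and> to_fract (u * \<pi> ^ i) = to_fract v * of_nat CARD('p) powi e"
  then obtain v where v: "v dvd 1" and eq: "to_fract (u * \<pi> ^ i) = to_fract v * of_nat CARD('p) powi e"
    by blast
  have nz: "(of_nat CARD('p) :: 'p padic) \<noteq> 0"
    by (metis to_fract_of_nat to_fract_eq_0_iff uniformizer_nonzero)
  show "e = int i"
  proof (cases "e \<ge> 0")
    case True
    then obtain j where j: "e = int j"
      by (metis nonneg_eq_int)
    have "to_fract (u * \<pi> ^ i) = to_fract (v * \<pi> ^ j)"
      using eq by (simp add: j to_fract_power to_fract_of_nat)
    then show ?thesis
      using padic_unit_power_unique[OF u v, of i j] j by (simp only: to_fract_eq_iff)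
  next
    case False
    define j where "j = nat (- e)"
    have j: "e = - int j" "j \<noteq> 0"
      using False by (simp_all add: j_def)
    \<comment> \<open>For negative e the power of p moves to the other side, and i + j = 0 then
      contradicts j > 0.\<close>
    have "to_fract (u * \<pi> ^ (i + j)) = to_fract (v * \<pi> ^ 0)"
      using eq nz by (simp add: j to_fract_power to_fract_of_nat power_int_minus power_add field_simps)
    then have "i + j = 0"
      using padic_unit_power_unique[OF u v, of "i + j" 0] by (simp only: to_fract_eq_iff)
    with j show ?thesis by simp
  qed
qed

section \<open>Splitting of the cocycle over the maximal compact subgroup\<close>

definition int_mat ::
  "'p::prime_card padic_int \<Rightarrow> 'p padic_int \<Rightarrow> 'p padic_int \<Rightarrow> 'p padic_int \<Rightarrow> 'p padic_mat" where
  "int_mat a b c d = vector [vector [to_fract a, to_fract b], vector [to_fract c, to_fract d]]"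

lemma int_mat_nth [simp]:
  "int_mat a b c d $ 1 $ 1 = to_fract a" "int_mat a b c d $ 1 $ 2 = to_fract b"
  "int_mat a b c d $ 2 $ 1 = to_fract c" "int_mat a b c d $ 2 $ 2 = to_fract d"
  by (simp_all add: int_mat_def)

lemma int_mat_eqI:
  "A $ 1 $ 1 = to_fract a \<Longrightarrow> A $ 1 $ 2 = to_fract b \<Longrightarrow> A $ 2 $ 1 = to_fract c \<Longrightarrow> A $ 2 $ 2 = to_fract d
    \<Longrightarrow> A = int_mat a b c d"
  by (simp add: vec_eq_iff forall_2)

lemma int_mat_mult:
  "int_mat a b c d ** int_mat a' b' c' d'
    = int_mat (a * a' + b * c') (a * b' + b * d') (c * a' + d * c') (c * b' + d * d')"
  by (rule int_mat_eqI) (simp_all add: matrix_matrix_mult_def sum_2)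

lemma int_mat_1: "mat 1 = int_mat 1 0 0 1"
  by (rule int_mat_eqI) (simp_all add: mat_def)

lemma det_int_mat: "det (int_mat a b c d) = to_fract (a * d - b * c)"
  by (simp add: det_2)

lemma int_mat_in_SL2_Zp: "int_mat a b c d \<in> SL2_Zp \<longleftrightarrow> a * d - b * c = 1"
proof -
  have "det (int_mat a b c d) = 1 \<longleftrightarrow> a * d - b * c = 1"
    unfolding det_int_mat by (metis to_fract_1 to_fract_eq_iff)
  then show ?thesis
    by (simp add: SL2_Zp_def SL2_Qp_def forall_2)
qed

lemma SL2_ZpE:
  assumes "A \<in> SL2_Zp"
  obtains a b c d where "A = int_mat a b c d" "a * d - b * c = 1"
proof -
  from assms have "\<forall>i j. A $ i $ j \<in> range to_fract"
    by (simp add: SL2_Zp_def)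
  then obtain a b c d where "A $ 1 $ 1 = to_fract a" "A $ 1 $ 2 = to_fract b"
    "A $ 2 $ 1 = to_fract c" "A $ 2 $ 2 = to_fract d"
    by (metis imageE)
  then have "A = int_mat a b c d"
    by (rule int_mat_eqI)
  with assms that show ?thesis
    by (simp add: int_mat_in_SL2_Zp)
qed

lemma SL2_Zp_mult: "A \<in> SL2_Zp \<Longrightarrow> B \<in> SL2_Zp \<Longrightarrow> A ** B \<in> SL2_Zp"
proof (elim SL2_ZpE)
  fix a b c d a' b' c' d'
  assume "A = int_mat a b c d" "B = int_mat a' b' c' d'"
    and *: "a * d - b * c = 1" "a' * d' - b' * c' = 1"
  moreover have "(a * a' + b * c') * (c * b' + d * d') - (a * b' + b * d') * (c * a' + d * c')
      = (a * d - b * c) * (a' * d' - b' * c')"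
    by (simp add: algebra_simps)
  ultimately show ?thesis
    by (simp add: int_mat_mult int_mat_in_SL2_Zp)
qed

lemma tau_int_mat: "tau (int_mat a b c d) = to_fract (if c = 0 then d else c)"
  by (simp add: tau_def)

text \<open>Modulo p the determinant condition reads a d = 1.\<close>

lemma unit_diagonal:
  fixes a b c d :: "'p::prime_card padic_int"
  assumes "a * d - b * c = 1" "\<pi> dvd c"
  shows "a dvd 1" "d dvd 1"
proof -
  have "\<not> \<pi> dvd a * d"
    using assms dvd_diff[of \<pi> "a * d" "b * c"] uniformizer_not_unit[where 'p = 'p] by auto
  then show "a dvd 1" "d dvd 1"
    by (simp_all add: uniformizer_dvd_mult padic_unit_iff)
qed

lemma s_p_lower_zero: "s_p (int_mat a b 0 d) = 1"
  by (simp add: s_p_def)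

text \<open>For \<open>i = 0\<close> the entry \<open>d\<close> need not be a unit; the exponent then makes its symbol irrelevant.\<close>

lemma s_p_int_mat:
  fixes a b u d :: "'p::prime_card padic_int"
  assumes p: "odd CARD('p)" and u: "u dvd 1" and det: "a * d - b * (u * \<pi> ^ i) = 1"
  shows "s_p (int_mat a b (u * \<pi> ^ i) d) = padic_legendre d ^ i"
proof (cases "i = 0")
  case True
  then show ?thesis
    using padic_ord_eq[OF u, of 0] by (simp add: s_p_def)
next
  case False
  then have "\<pi> dvd u * \<pi> ^ i"
    by (simp add: dvd_power)
  then have d: "d dvd 1"
    using unit_diagonal[OF det] by blast
  then have "d \<noteq> 0" "u \<noteq> 0"
    using u by auto
  moreover have "hilbert_symbol (to_fract (u * \<pi> ^ i)) (to_fract d) = padic_legendre d ^ i"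
    using hilbert_symbol_tame[OF p u d, of i 0] by simp
  ultimately show ?thesis
    using padic_legendre_unit[OF d]
    unfolding s_p_def int_mat_nth padic_ord_eq[OF u] by (auto simp del: to_fract_mult)
qed

section \<open>The cocycle on a pair of matrices of K and their product\<close>

context
  fixes a b c d a' b' c' d' a'' b'' c'' d'' :: "'p::prime_card padic_int"
  assumes p: "odd CARD('p)"
    and det: "a * d - b * c = 1" and det': "a' * d' - b' * c' = 1"
    and c'': "c'' = c * a' + d * c'" and d'': "d'' = c * b' + d * d'"
    and a'': "a'' = a * a' + b * c'" and b'': "b'' = a * b' + b * d'"
begin

lemma det'': "a'' * d'' - b'' * c'' = 1"
proof -
  have "a'' * d'' - b'' * c'' = (a * d - b * c) * (a' * d' - b' * c')"
    unfolding a'' b'' c'' d'' by (simp add: algebra_simps)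
  then show ?thesis
    by (simp add: det det')
qed

text \<open>These are the lower left entries of g = (gh) h^-1 and h = g^-1 (gh). They put c, c' and
  c'' on an equal footing, each being a combination of the other two.\<close>

lemma lower_left_of_quotients: "c = c'' * d' - d'' * c'" "c' = a * c'' - c * a''"
proof -
  have "c'' * d' - d'' * c' = c * (a' * d' - b' * c')" "a * c'' - c * a'' = (a * d - b * c) * c'"
    unfolding a'' b'' c'' d'' by (simp_all add: algebra_simps)
  then show "c = c'' * d' - d'' * c'" "c' = a * c'' - c * a''"
    by (simp_all add: det det')
qed

lemma legendre_dvd_mult:
  assumes "v dvd 1" "w dvd 1" "\<pi> dvd (u :: 'p padic_int) - v * w"
  shows "padic_legendre u = padic_legendre v * padic_legendre w"
  using padic_legendre_cong[OF assms(3)] padic_legendre_mult[OF p assms(1,2)] by simp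

lemma legendre_neg:
  "v dvd 1 \<Longrightarrow> padic_legendre (- v :: 'p padic_int) = padic_legendre (- 1 :: 'p padic_int) * padic_legendre v"
  using padic_legendre_mult[OF p, of "- 1" v] by simp

lemma legendre_lower_right:
  assumes "\<pi> dvd c" "\<pi> dvd c'"
  shows "padic_legendre d'' = padic_legendre d * padic_legendre d'"
  using assms unit_diagonal[OF det] unit_diagonal[OF det']
  by (intro legendre_dvd_mult) (auto simp: d'')

text \<open>Modulo p the product a' d' is 1, and two signs with product 1 are equal.\<close>

lemma legendre_diagonal:
  assumes "\<pi> dvd c'"
  shows "padic_legendre a' = padic_legendre d'"
proof -
  have ad: "a' dvd 1" "d' dvd 1"
    using unit_diagonal[OF det' assms] by auto
  have "a' * d' = 1 + b' * c'"
    using det' by (simp add: diff_eq_eq)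
  then have "\<pi> dvd 1 - a' * d'"
    using assms by simp
  then have "padic_legendre a' * padic_legendre d' = 1"
    using legendre_dvd_mult[OF ad] padic_legendre_one[where 'p = 'p] by simp
  then show ?thesis
    using padic_legendre_unit[OF ad(1)] padic_legendre_unit[OF ad(2)] by auto
qed

text \<open>This is c(g, h) = 1 when no lower left entry vanishes. The first three factors are
  \<open>sigma0\<close> by the tame formula, for arguments of orders \<gamma> + \<alpha> and
  \<gamma> + \<beta>; the last three are the values of \<open>s_p\<close>.\<close>

lemma tame_identity:
  assumes u: "u dvd 1" "c = u * \<pi> ^ \<alpha>" and u': "u' dvd 1" "c' = u' * \<pi> ^ \<beta>"
    and u'': "u'' dvd 1" "c'' = u'' * \<pi> ^ \<gamma>"
  defines "L \<equiv> padic_legendre :: 'p padic_int \<Rightarrow> int"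
  shows "L (- 1) ^ ((\<gamma> + \<alpha>) * (\<gamma> + \<beta>)) * (L u'' * L u) ^ (\<gamma> + \<beta>) * (L u'' * L u') ^ (\<gamma> + \<alpha>)
    * L d ^ \<alpha> * L d' ^ \<beta> * L d'' ^ \<gamma> = 1"
proof -
  have pos: "\<pi> dvd c \<longleftrightarrow> \<alpha> > 0" "\<pi> dvd c'  \<longleftrightarrow> \<beta> > 0" "\<pi> dvd c'' \<longleftrightarrow> \<gamma> > 0"
  proof -
    have "\<pi> dvd v * \<pi> ^ k \<longleftrightarrow> k > 0" if "v dvd 1" for v :: "'p padic_int" and k
      using that by (cases k) (auto simp: padic_unit_iff)
    then show "\<pi> dvd c \<longleftrightarrow> \<alpha> > 0" "\<pi> dvd c'  \<longleftrightarrow> \<beta> > 0" "\<pi> dvd c'' \<longleftrightarrow> \<gamma> > 0"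
      using u u' u'' by auto
  qed
  \<comment> \<open>If p divides two of the lower left entries it divides the third, so only five
    patterns of positive orders survive.\<close>
  have third: "\<alpha> > 0 \<Longrightarrow> \<beta> > 0 \<Longrightarrow> \<gamma> > 0" "\<alpha> > 0 \<Longrightarrow> \<gamma> > 0 \<Longrightarrow> \<beta> > 0" "\<beta> > 0 \<Longrightarrow> \<gamma> > 0 \<Longrightarrow> \<alpha> > 0"
  proof -
    show "\<alpha> > 0 \<Longrightarrow> \<beta> > 0 \<Longrightarrow> \<gamma> > 0"
      unfolding pos[symmetric] c'' by (intro dvd_add dvd_mult dvd_mult2)
    show "\<alpha> > 0 \<Longrightarrow> \<gamma> > 0 \<Longrightarrow> \<beta> > 0"
      unfolding pos[symmetric] by (subst lower_left_of_quotients(2)) (intro dvd_diff dvd_mult dvd_mult2)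
    show "\<beta> > 0 \<Longrightarrow> \<gamma> > 0 \<Longrightarrow> \<alpha> > 0"
      unfolding pos[symmetric] by (subst lower_left_of_quotients(1)) (intro dvd_diff dvd_mult dvd_mult2)
  qed
  have sq: "L v = 1 \<or> L v = - 1" if "v dvd 1" for v
    using padic_legendre_unit[OF that] unfolding L_def .
  note signs = sq[OF u(1)] sq[OF u'(1)] sq[OF u''(1)] sq[of "- 1"]
  consider "\<alpha> = 0" "\<beta> = 0" "\<gamma> = 0" | "\<alpha> = 0" "\<beta> = 0" "\<gamma> > 0" | "\<alpha> > 0" "\<beta> = 0" "\<gamma> = 0"
    | "\<alpha> = 0" "\<beta> > 0" "\<gamma> = 0" | "\<alpha> > 0" "\<beta> > 0" "\<gamma> > 0"
    using third by (metis gr0I)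
  then show ?thesis
  proof cases
    case 1
    then show ?thesis by simp
  next
    case 2
    have d: "d'' dvd 1"
      using unit_diagonal[OF det''] pos 2 by blast
    \<comment> \<open>Modulo p the relation c = c'' d' - d'' c' loses its first term; the other
      mixed cases use the same device.\<close>
    have "\<pi> dvd c - (- d'') * c'"
      using lower_left_of_quotients(1) pos 2 by simp
    then have "L u = L (- 1) * L d'' * L u'"
      using legendre_dvd_mult[of "- d''" u' u] legendre_neg[OF d] d u u' 2 by (simp add: L_def)
    with 2 signs sq[OF d] show ?thesis
      by (cases "even \<gamma>") (auto simp: minus_one_power_iff power_mult_distrib)
  next
    case 3
    have d: "d dvd 1"
      using unit_diagonal[OF det] pos 3 by blast
    have "\<pi> dvd c'' - d * c'"
      using c'' pos 3 by simp
    then have "L u'' = L d * L u'"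
      using legendre_dvd_mult[of d u' u''] d u' u'' 3 by (simp add: L_def)
    with 3 signs sq[OF d] show ?thesis
      by (cases "even \<alpha>") (auto simp: minus_one_power_iff)
  next
    case 4
    have d: "d' dvd 1"
      using unit_diagonal[OF det'] pos 4 by blast
    have "\<pi> dvd c - c'' * d'"
      using lower_left_of_quotients(1) pos 4 by simp
    then have "L u = L u'' * L d'"
      using legendre_dvd_mult[of u'' d' u] d u u'' 4 by (simp add: L_def)
    with 4 signs sq[OF d] show ?thesis
      by (cases "even \<beta>") (auto simp: minus_one_power_iff)
  next
    case 5
    have d: "d dvd 1" "d' dvd 1" "a' dvd 1"
      using unit_diagonal[OF det] unit_diagonal[OF det'] pos 5 by blast+
    have Ld'': "L d'' = L d * L d'" and La': "L a' = L d'"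
      using legendre_lower_right legendre_diagonal pos 5 by (simp_all add: L_def)
    have eq: "u'' * \<pi> ^ \<gamma> = u * \<pi> ^ \<alpha> * a' + d * (u' * \<pi> ^ \<beta>)"
      using c'' u u' u'' by simp
    have cancel: "x = y" if "x * \<pi> ^ k = y * \<pi> ^ k" for x y :: "'p padic_int" and k
      using that by simp
    have mult_unit: "v * w dvd 1" if "v dvd 1" "w dvd 1" for v w :: "'p padic_int"
      using mult_dvd_mono[OF that] by simp
    \<comment> \<open>If \<alpha> and \<beta> differ, \<gamma> is the smaller one and the leading
      unit of c'' comes from the dominant summand. If they agree, cancellation may make \<gamma>
      larger.\<close>
    consider "\<alpha> < \<beta>" | "\<beta> < \<alpha>" | "\<alpha> = \<beta>"
      by linarith
    then show ?thesis
    proof cases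
      case 1
      have pi: "\<pi> dvd (\<pi> :: 'p padic_int) ^ (\<beta> - \<alpha>)"
        using 1 by (simp add: dvd_power)
      define v where "v = u * a' + d * u' * \<pi> ^ (\<beta> - \<alpha>)"
      have "\<pi> ^ \<beta> = (\<pi> :: 'p padic_int) ^ \<alpha> * \<pi> ^ (\<beta> - \<alpha>)"
        using 1 by (simp flip: power_add)
      then have v: "u'' * \<pi> ^ \<gamma> = v * \<pi> ^ \<alpha>"
        using eq by (simp add: v_def algebra_simps)
      have vd: "\<pi> dvd v - u * a'"
        using pi by (simp add: v_def)
      then have "v dvd 1"
        using uniformizer_dvd_diff_cong[OF vd] mult_unit[OF u(1) d(3)] by (simp add: padic_unit_iff)
      then have "\<gamma> = \<alpha>"
        using padic_unit_power_unique[OF u''(1) _ v] by blast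
      moreover from this v have "u'' = v"
        by (simp only: cancel[where k = \<alpha>])
      then have "L u'' = L u * L d'"
        using legendre_dvd_mult[OF u(1) d(3)] vd La' by (simp add: L_def)
      ultimately show ?thesis
        using signs sq[OF d(1)] sq[OF d(2)] Ld''
        by (cases "even \<alpha>"; cases "even \<beta>") (auto simp: minus_one_power_iff)
    next
      case 2
      have pi: "\<pi> dvd (\<pi> :: 'p padic_int) ^ (\<alpha> - \<beta>)"
        using 2 by (simp add: dvd_power)
      define v where "v = d * u' + u * a' * \<pi> ^ (\<alpha> - \<beta>)"
      have "\<pi> ^ \<alpha> = (\<pi> :: 'p padic_int) ^ \<beta> * \<pi> ^ (\<alpha> - \<beta>)"
        using 2 by (simp flip: power_add)
      then have v: "u'' * \<pi> ^ \<gamma> = v * \<pi> ^ \<beta>"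
        using eq by (simp add: v_def algebra_simps)
      have vd: "\<pi> dvd v - d * u'"
        using pi by (simp add: v_def)
      then have "v dvd 1"
        using uniformizer_dvd_diff_cong[OF vd] mult_unit[OF d(1) u'(1)] by (simp add: padic_unit_iff)
      then have "\<gamma> = \<beta>"
        using padic_unit_power_unique[OF u''(1) _ v] by blast
      moreover from this v have "u'' = v"
        by (simp only: cancel[where k = \<beta>])
      then have "L u'' = L d * L u'"
        using legendre_dvd_mult[OF d(1) u'(1)] vd by (simp add: L_def)
      ultimately show ?thesis
        using signs sq[OF d(1)] sq[OF d(2)] Ld''
        by (cases "even \<alpha>"; cases "even \<beta>") (auto simp: minus_one_power_iff)
    next
      case 3
      have v: "u'' * \<pi> ^ \<gamma> = (u * a' + d * u') * \<pi> ^ \<alpha>"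
        using eq 3 by (simp add: algebra_simps)
      consider "\<gamma> < \<alpha>" | "\<gamma> = \<alpha>" | "\<alpha> < \<gamma>"
        by linarith
      then show ?thesis
      proof cases
        case 1
        then have "\<pi> ^ \<alpha> = (\<pi> :: 'p padic_int) ^ (\<alpha> - \<gamma>) * \<pi> ^ \<gamma>"
          by (simp flip: power_add)
        with v have "u'' * \<pi> ^ \<gamma> = (u * a' + d * u') * \<pi> ^ (\<alpha> - \<gamma>) * \<pi> ^ \<gamma>"
          by (simp only: mult.assoc)
        then have "u'' = (u * a' + d * u') * \<pi> ^ (\<alpha> - \<gamma>)"
          by (rule cancel)
        moreover have "\<pi> dvd (\<pi> :: 'p padic_int) ^ (\<alpha> - \<gamma>)"
          using 1 by (simp add: dvd_power)
        ultimately have "\<pi> dvd u''"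
          by simp
        then show ?thesis
          using u'' by (simp add: padic_unit_iff)
      next
        \<comment> \<open>All orders are equal, so the exponents from \<open>sigma0\<close> are even
          and only the symbols of d, d' and d'' remain.\<close>
        case 2
        with \<open>\<alpha> = \<beta>\<close> signs sq[OF d(1)] sq[OF d(2)] Ld'' show ?thesis
          by (cases "even \<alpha>") (auto simp: minus_one_power_iff)
      next
        case 3
        then have "\<pi> ^ \<gamma> = (\<pi> :: 'p padic_int) ^ (\<gamma> - \<alpha>) * \<pi> ^ \<alpha>"
          by (simp flip: power_add)
        with v have "(u * a' + d * u') * \<pi> ^ \<alpha> = u'' * \<pi> ^ (\<gamma> - \<alpha>) * \<pi> ^ \<alpha>"
          by (simp only: mult.assoc)
        then have "u * a' + d * u' = u'' * \<pi> ^ (\<gamma> - \<alpha>)"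
          by (rule cancel)
        moreover have "\<pi> dvd (\<pi> :: 'p padic_int) ^ (\<gamma> - \<alpha>)"
          using 3 by (simp add: dvd_power)
        \<comment> \<open>The order of c'' exceeds \<alpha>, so the leading terms cancel: u a' and
          -d u' agree modulo p.\<close>
        ultimately have "\<pi> dvd u * a' - (- d) * u'"
          by simp
        then have "L (u * a') = L (- 1) * L d * L u'"
          using legendre_dvd_mult[of "- d" u' "u * a'"] legendre_neg[OF d(1)] d u' by (simp add: L_def)
        moreover have "L (u * a') = L u * L d'"
          using padic_legendre_mult[OF p u(1) d(3)] La' by (simp add: L_def)
        ultimately have "L u * L d' = L (- 1) * L d * L u'"
          by simp
        with \<open>\<alpha> = \<beta>\<close> signs sq[OF d(1)] sq[OF d(2)] Ld'' show ?thesis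
          by (cases "even \<alpha>"; cases "even \<gamma>") (auto simp: minus_one_power_iff)
      qed
    qed
  qed
qed

text \<open>When a lower left entry vanishes, \<open>tau\<close> takes the lower right entry instead
  and \<open>tame_identity\<close> does not apply. Two vanishing entries force the third to vanish.
  If exactly one vanishes, the other two agree up to a unit factor, so a single order governs all
  symbols.\<close>

lemma cocycle_int_mat: "cocycle (int_mat a b c d) (int_mat a' b' c' d') = 1"
proof -
  define L where "L = (padic_legendre :: 'p padic_int \<Rightarrow> int)"
  have sq: "L v = 1 \<or> L v = - 1" if "v dvd 1" for v
    using padic_legendre_unit[OF that] unfolding L_def .
  have mult: "L (v * w) = L v * L w" if "v dvd 1" "w dvd 1" for v w
    using padic_legendre_mult[OF p that] unfolding L_def .
  have mult_unit: "v * w dvd 1" if "v dvd 1" "w dvd 1" for v w :: "'p padic_int"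
    using mult_dvd_mono[OF that] by simp
  have tame: "hilbert_symbol (to_fract (v * \<pi> ^ i)) (to_fract (w * \<pi> ^ j))
      = L (- 1) ^ (i * j) * L v ^ j * L w ^ i" if "v dvd 1" "w dvd 1" for v w i j
    using hilbert_symbol_tame[OF p that] unfolding L_def .
  have s: "s_p (int_mat x y (v * \<pi> ^ i) z) = L z ^ i" if "v dvd 1" "x * z - y * (v * \<pi> ^ i) = 1"
    for x y z v i
    using s_p_int_mat[OF p that] unfolding L_def .
  have pi: "\<pi> dvd v * \<pi> ^ k" if "k \<noteq> 0" for v :: "'p padic_int" and k
    using that by (simp add: dvd_power)
  define t where "t = (if c = 0 then d else c)"
  define t' where "t' = (if c' = 0 then d' else c')"
  define t'' where "t'' = (if c'' = 0 then d'' else c'')"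
  have coc: "cocycle (int_mat a b c d) (int_mat a' b' c' d')
      = hilbert_symbol (to_fract (t'' * t)) (to_fract (t'' * t'))
        * s_p (int_mat a b c d) * s_p (int_mat a' b' c' d') * s_p (int_mat a'' b'' c'' d'')"
    unfolding cocycle_def sigma0_def int_mat_mult tau_int_mat
    by (simp only: a'' b'' c'' d'' t_def t'_def t''_def to_fract_mult)
  consider "c = 0" "c' = 0" | "c = 0" "c' \<noteq> 0" | "c \<noteq> 0" "c' = 0" | "c \<noteq> 0" "c' \<noteq> 0" "c'' = 0"
    | "c \<noteq> 0" "c' \<noteq> 0" "c'' \<noteq> 0"
    by blast
  then show ?thesis
  proof cases
    case 1
    then have "c'' = 0" by (simp add: c'')
    have d: "d dvd 1" "d' dvd 1" "d'' dvd 1"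
      using unit_diagonal[OF det] unit_diagonal[OF det'] unit_diagonal[OF det''] 1 \<open>c'' = 0\<close> by simp_all
    then have "hilbert_symbol (to_fract (t'' * t)) (to_fract (t'' * t')) = 1"
      using 1 \<open>c'' = 0\<close> unfolding t_def t'_def t''_def
      by (intro hilbert_symbol_units[OF p] mult_unit) simp_all
    then show ?thesis
      unfolding coc using 1 \<open>c'' = 0\<close> by (simp add: s_p_lower_zero)
  next
    case 2
    obtain u' \<beta> where u': "u' dvd 1" "c' = u' * \<pi> ^ \<beta>"
      using padic_decompose[OF 2(2)] .
    have d: "d dvd 1"
      using unit_diagonal[OF det] 2 by simp
    have c''_eq: "c'' = d * u' * \<pi> ^ \<beta>" and d''_eq: "d'' = d * d'"
      using 2 u' by (simp_all add: c'' d'')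
    have nz: "c'' \<noteq> 0"
      using 2 d by (auto simp: c'')
    have units: "d * u' * d dvd 1" "d * u' * u' dvd 1" "d * u' dvd 1"
      using d u' by (simp_all add: mult_unit)
    have "t'' * t = (d * u' * d) * \<pi> ^ \<beta>" "t'' * t' = (d * u' * u') * \<pi> ^ (\<beta> + \<beta>)"
      using 2 nz by (simp_all add: t_def t'_def t''_def c''_eq u'(2) power_add mult_ac)
    then have "hilbert_symbol (to_fract (t'' * t)) (to_fract (t'' * t'))
        = L (- 1) ^ (\<beta> * (\<beta> + \<beta>)) * L (d * u' * d) ^ (\<beta> + \<beta>) * L (d * u' * u') ^ \<beta>"
      using tame[OF units(1,2)] by (simp only:)
    also have "\<dots> = L d ^ \<beta>"
      using d u' sq[OF d] sq[OF u'(1)] sq[of "- 1"]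
      by (simp add: mult mult_unit) (auto simp: minus_one_power_iff)
    finally have h: "hilbert_symbol (to_fract (t'' * t)) (to_fract (t'' * t')) = L d ^ \<beta>" .
    \<comment> \<open>For \<beta> = 0 the entry d' may be a nonunit with symbol 0, so
      multiplicativity is invoked for \<beta> > 0 only.\<close>
    have "L d ^ \<beta> * L d' ^ \<beta> * L d'' ^ \<beta> = 1"
    proof (cases "\<beta> = 0")
      case False
      then have d': "d' dvd 1"
        using unit_diagonal(2)[OF det'] pi u' by simp
      then show ?thesis
        using sq[OF d] sq[OF d'] by (auto simp: d''_eq mult d minus_one_power_iff)
    qed simp
    moreover have "s_p (int_mat a' b' c' d') = L d' ^ \<beta>" "s_p (int_mat a'' b'' c'' d'') = L d'' ^ \<beta>"
      using s u' units det' det'' c''_eq by simp_all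
    ultimately show ?thesis
      unfolding coc h using 2 by (simp add: s_p_lower_zero)
  next
    case 3
    obtain u \<alpha> where u: "u dvd 1" "c = u * \<pi> ^ \<alpha>"
      using padic_decompose[OF 3(1)] .
    have d': "d' dvd 1" "a' dvd 1"
      using unit_diagonal[OF det'] 3 by simp_all
    have ad: "a' * d' = 1"
      using det' 3 by simp
    have c''_eq: "c'' = u * a' * \<pi> ^ \<alpha>"
      using 3 u by (simp add: c'')
    have nz: "c'' \<noteq> 0"
      using 3 d' by (auto simp: c'')
    have units: "u * a' * u dvd 1" "u dvd 1" "u * a' dvd 1"
      using d' u by (simp_all add: mult_unit)
    have "t'' * t = (u * a' * u) * \<pi> ^ (\<alpha> + \<alpha>)"
      using 3 nz by (simp add: t_def t''_def c''_eq u(2) power_add mult_ac)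
    \<comment> \<open>Here \<open>tau\<close> of the second matrix is d', and it disappears because
      a' d' = 1.\<close>
    moreover have "t'' * t' = u * (a' * d') * \<pi> ^ \<alpha>"
      using 3 nz by (simp add: t'_def t''_def c''_eq mult_ac)
    ultimately have "hilbert_symbol (to_fract (t'' * t)) (to_fract (t'' * t'))
        = L (- 1) ^ ((\<alpha> + \<alpha>) * \<alpha>) * L (u * a' * u) ^ \<alpha> * L u ^ (\<alpha> + \<alpha>)"
      using tame[OF units(1,2)] by (simp only: ad mult_1_right)
    also have "\<dots> = L a' ^ \<alpha>"
      using d' u sq[OF d'(2)] sq[OF u(1)] sq[of "- 1"]
      by (simp add: mult mult_unit) (auto simp: minus_one_power_iff)
    also have "L a' = L d'"
      using legendre_diagonal 3 by (simp add: L_def)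
    finally have h: "hilbert_symbol (to_fract (t'' * t)) (to_fract (t'' * t')) = L d' ^ \<alpha>" .
    have "L d' ^ \<alpha> * L d ^ \<alpha> * L d'' ^ \<alpha> = 1"
    proof (cases "\<alpha> = 0")
      case False
      then have "\<pi> dvd c"
        using pi u by simp
      then have d: "d dvd 1" and "L d'' = L d * L d'"
        using unit_diagonal(2)[OF det] legendre_lower_right 3 by (simp_all add: L_def)
      then show ?thesis
        using sq[OF d] sq[OF d'(1)] by (auto simp: minus_one_power_iff)
    qed simp
    moreover have "s_p (int_mat a b c d) = L d ^ \<alpha>" "s_p (int_mat a'' b'' c'' d'') = L d'' ^ \<alpha>"
      using s u units det det'' c''_eq by simp_all
    ultimately show ?thesis
      unfolding coc h using 3 by (simp add: s_p_lower_zero)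
  next
    case 4
    obtain u' \<beta> where u': "u' dvd 1" "c' = u' * \<pi> ^ \<beta>"
      using padic_decompose[OF 4(2)] .
    have d'': "d'' dvd 1"
      using unit_diagonal[OF det''] 4 by simp
    \<comment> \<open>The sign in this relation produces the symbol of -1, whose total exponent
      \<beta> * \<beta> + \<beta> is even.\<close>
    have c_eq: "c = - (d'' * u') * \<pi> ^ \<beta>"
      using lower_left_of_quotients(1) 4 u' by simp
    have units: "- (d'' * d'' * u') dvd 1" "d'' * u' dvd 1" "- (d'' * u') dvd 1" "d'' * d'' * u' dvd 1" "d'' * d'' dvd 1"
      using d'' u' by (simp_all add: mult_unit)
    have "t'' * t = - (d'' * d'' * u') * \<pi> ^ \<beta>" "t'' * t' = d'' * u' * \<pi> ^ \<beta>"
      using 4 by (simp_all add: t_def t'_def t''_def c_eq u'(2) mult_ac)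
    then have "hilbert_symbol (to_fract (t'' * t)) (to_fract (t'' * t'))
        = L (- 1) ^ (\<beta> * \<beta>) * L (- (d'' * d'' * u')) ^ \<beta> * L (d'' * u') ^ \<beta>"
      using tame[OF units(1,2)] by (simp only:)
    also have "L (- (d'' * d'' * u')) = L (- 1) * L (d'' * d'' * u')"
      using legendre_neg[OF units(4)] by (simp add: L_def)
    also have "L (- 1) ^ (\<beta> * \<beta>) * (L (- 1) * L (d'' * d'' * u')) ^ \<beta> * L (d'' * u') ^ \<beta> = L d'' ^ \<beta>"
      using d'' u' units sq[OF d''] sq[OF u'(1)] sq[of "- 1"]
      by (simp add: mult) (auto simp: minus_one_power_iff)
    finally have h: "hilbert_symbol (to_fract (t'' * t)) (to_fract (t'' * t')) = L d'' ^ \<beta>" .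
    have "L d'' ^ \<beta> * L d ^ \<beta> * L d' ^ \<beta> = 1"
    proof (cases "\<beta> = 0")
      case False
      then have "\<pi> dvd c" "\<pi> dvd c'"
        using pi u'(2) c_eq by simp_all
      then have d: "d dvd 1" "d' dvd 1" and "L d'' = L d * L d'"
        using unit_diagonal(2)[OF det] unit_diagonal(2)[OF det'] legendre_lower_right
        by (simp_all add: L_def)
      then show ?thesis
        using sq[OF d(1)] sq[OF d(2)] by (auto simp: minus_one_power_iff)
    qed simp
    moreover have "s_p (int_mat a b c d) = L d ^ \<beta>" "s_p (int_mat a' b' c' d') = L d' ^ \<beta>"
      using s[OF units(3), of a d b \<beta>] s[OF u'(1)] u' det det' c_eq by simp_all
    ultimately show ?thesis
      unfolding coc h using 4 by (simp add: s_p_lower_zero)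
  next
    case 5
    obtain u \<alpha> where u: "u dvd 1" "c = u * \<pi> ^ \<alpha>"
      using padic_decompose[OF 5(1)] .
    obtain u' \<beta> where u': "u' dvd 1" "c' = u' * \<pi> ^ \<beta>"
      using padic_decompose[OF 5(2)] .
    obtain u'' \<gamma> where u'': "u'' dvd 1" "c'' = u'' * \<pi> ^ \<gamma>"
      using padic_decompose[OF 5(3)] .
    have "t'' * t = (u'' * u) * \<pi> ^ (\<gamma> + \<alpha>)" "t'' * t' = (u'' * u') * \<pi> ^ (\<gamma> + \<beta>)"
      unfolding t_def t'_def t''_def power_add using 5 by (simp_all add: u(2) u'(2) u''(2) mult_ac)
    then have h: "hilbert_symbol (to_fract (t'' * t)) (to_fract (t'' * t'))
        = L (- 1) ^ ((\<gamma> + \<alpha>) * (\<gamma> + \<beta>)) * (L u'' * L u) ^ (\<gamma> + \<beta>) * (L u'' * L u') ^ (\<gamma> + \<alpha>)"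
      using tame[OF mult_unit[OF u''(1) u(1)] mult_unit[OF u''(1) u'(1)]]
      by (simp only: mult u u' u'')
    have "s_p (int_mat a b c d) = L d ^ \<alpha>" "s_p (int_mat a' b' c' d') = L d' ^ \<beta>"
      "s_p (int_mat a'' b'' c'' d'') = L d'' ^ \<gamma>"
      using s[OF u(1)] s[OF u'(1)] s[OF u''(1)] u u' u'' det det' det'' by simp_all
    then show ?thesis
      unfolding coc h using tame_identity[OF u u' u''] by (simp add: L_def)
  qed
qed

end

theorem cocycle_SL2_Zp:
  fixes A B :: "'p::prime_card padic_mat"
  assumes "odd CARD('p)" "A \<in> SL2_Zp" "B \<in> SL2_Zp"
  shows "cocycle A B = 1"
  using assms by (elim SL2_ZpE) (simp add: cocycle_int_mat)

section \<open>Compactness of the maximal compact subgroup\<close>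

text \<open>Subdivision argument: \<open>\<rho> m\<close> sorts X into finitely many cells at level
  m. Without a finite subcover of X, a cell that has none can be chosen at every level with matching
  labels; the limit point granted by \<open>complete\<close> lies in a member of the cover that
  contains one of these cells.\<close>

lemma compactin_by_refinement:
  fixes \<rho> :: "nat \<Rightarrow> 'a \<Rightarrow> 'b"
  assumes sub: "X \<subseteq> topspace T"
    and fin: "\<And>m. finite (\<rho> m ` X)"
    and complete: "\<And>x. (\<And>m. x m \<in> X) \<Longrightarrow> (\<And>m. \<rho> m (x (Suc m)) = \<rho> m (x m))
      \<Longrightarrow> \<exists>a\<in>X. \<forall>m. \<rho> m a = \<rho> m (x m)"
    and nbhd: "\<And>U a. openin T U \<Longrightarrow> a \<in> U \<Longrightarrow> a \<in> X \<Longrightarrow> \<exists>m. \<forall>y\<in>X. \<rho> m y = \<rho> m a \<longrightarrow> y \<in> U"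
  shows "compactin T X"
  unfolding compactin_def
proof (intro conjI sub allI impI)
  fix \<U>
  assume \<U>: "(\<forall>U\<in>\<U>. openin T U) \<and> X \<subseteq> \<Union> \<U>"
  define good where "good S \<longleftrightarrow> (\<exists>\<F>. finite \<F> \<and> \<F> \<subseteq> \<U> \<and> S \<subseteq> \<Union> \<F>)" for S
  define cell where "cell m x = {y \<in> X. \<rho> m y = \<rho> m x}" for m x
  have split: "\<exists>y\<in>S. \<not> good (cell m y)" if "S \<subseteq> X" "\<not> good S" for S m
  proof (rule ccontr)
    assume "\<not> ?thesis"
    then have "\<forall>y\<in>S. \<exists>\<F>. finite \<F> \<and> \<F> \<subseteq> \<U> \<and> cell m y \<subseteq> \<Union> \<F>"
      by (auto simp: good_def)
    then obtain F where F: "\<And>y. y \<in> S \<Longrightarrow> finite (F y) \<and> F y \<subseteq> \<U> \<and> cell m y \<subseteq> \<Union> (F y)"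
      by metis
    have "finite (\<rho> m ` S)"
      using fin[of m] that(1) by (meson finite_subset image_mono)
    \<comment> \<open>One representative for each of the finitely many labels; the subfamilies
      attached to them already cover S.\<close>
    then obtain R where R: "finite R" "R \<subseteq> S" "\<rho> m ` S = \<rho> m ` R"
      by (metis finite_subset_image order_refl)
    have "S \<subseteq> \<Union> (\<Union> (F ` R))"
    proof
      fix y assume "y \<in> S"
      then obtain z where z: "z \<in> R" "\<rho> m y = \<rho> m z"
        using R(3) by (metis image_eqI imageE)
      then have "y \<in> cell m z"
        using \<open>y \<in> S\<close> that(1) by (auto simp: cell_def)
      then show "y \<in> \<Union> (\<Union> (F ` R))"
        using F[of z] z(1) R(2) by blast
    qed
    moreover have "finite (\<Union> (F ` R))" "\<Union> (F ` R) \<subseteq> \<U>"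
      using F R by blast+
    ultimately show False
      using that(2) unfolding good_def by blast
  qed
  have "good X"
  proof (rule ccontr)
    assume bad: "\<not> good X"
    have "\<exists>x. \<forall>m. (x m \<in> X \<and> \<not> good (cell m (x m))) \<and> \<rho> m (x (Suc m)) = \<rho> m (x m)"
    proof (rule dependent_nat_choice)
      show "\<exists>x. x \<in> X \<and> \<not> good (cell 0 x)"
        using split[OF order_refl bad] by blast
      fix x m
      assume "x \<in> X \<and> \<not> good (cell m x)"
      then obtain y where "y \<in> cell m x" "\<not> good (cell (Suc m) y)"
        using split[of "cell m x" "Suc m"] by (auto simp: cell_def)
      then show "\<exists>y. (y \<in> X \<and> \<not> good (cell (Suc m) y)) \<and> \<rho> m y = \<rho> m x"
        by (auto simp: cell_def)
    qed
    then obtain x where x: "\<And>m. x m \<in> X" "\<And>m. \<not> good (cell m (x m))"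
        "\<And>m. \<rho> m (x (Suc m)) = \<rho> m (x m)"
      by blast
    obtain a where a: "a \<in> X" "\<And>m. \<rho> m a = \<rho> m (x m)"
      using complete[of x] x by blast
    then obtain U where U: "U \<in> \<U>" "a \<in> U"
      using \<U> by blast
    then obtain m where "\<forall>y\<in>X. \<rho> m y = \<rho> m a \<longrightarrow> y \<in> U"
      using nbhd \<U> a(1) by blast
    then have "cell m (x m) \<subseteq> \<Union> {U}"
      using a by (auto simp: cell_def)
    then have "good (cell m (x m))"
      using U unfolding good_def by (intro exI[of _ "{U}"]) simp
    with x(2) show False by blast
  qed
  then show "\<exists>\<F>. finite \<F> \<and> \<F> \<subseteq> \<U> \<and> X \<subseteq> \<Union> \<F>"
    by (simp add: good_def)
qed

section \<open>Compactness of the preimage of K\<close>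

definition entry :: "'p::prime_card padic_mat \<Rightarrow> 2 \<Rightarrow> 2 \<Rightarrow> 'p padic_int" where
  "entry A i j = the_inv to_fract (A $ i $ j)"

lemma the_inv_to_fract: "the_inv to_fract (to_fract x) = x"
  by (rule the_inv_f_f) (simp add: inj_def)

lemma entry_int_mat [simp]:
  "entry (int_mat a b c d) 1 1 = a" "entry (int_mat a b c d) 1 2 = b"
  "entry (int_mat a b c d) 2 1 = c" "entry (int_mat a b c d) 2 2 = d"
  by (simp_all add: entry_def the_inv_to_fract)

lemma SL2_Zp_entry:
  assumes "A \<in> SL2_Zp"
  shows "A = int_mat (entry A 1 1) (entry A 1 2) (entry A 2 1) (entry A 2 2)"
    and "entry A 1 1 * entry A 2 2 - entry A 1 2 * entry A 2 1 = 1"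
  using assms by (elim SL2_ZpE; simp)+

lemma int_mat_in_principal_congruence:
  fixes a b c d :: "'p::prime_card padic_int"
  shows "int_mat a b c d \<in> principal_congruence m \<longleftrightarrow>
    a * d - b * c = 1 \<and> \<pi> ^ m dvd a - 1 \<and> \<pi> ^ m dvd b \<and> \<pi> ^ m dvd c \<and> \<pi> ^ m dvd d - 1"
proof -
  have *: "(\<exists>z. to_fract x - to_fract y = to_fract (\<pi> ^ m * z)) \<longleftrightarrow> \<pi> ^ m dvd x - y"
    for x y :: "'p padic_int"
    unfolding to_fract_diff[symmetric] to_fract_eq_iff dvd_def ..
  show ?thesis
    unfolding principal_congruence_def int_mat_1 mem_Collect_eq int_mat_in_SL2_Zp forall_2 int_mat_nth * by simp
qed

lemma Mp_mult: "(A, e) \<otimes>\<^bsub>Mp\<^esub> (B, e') = (A ** B, e * e' * cocycle A B)"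
  by (simp add: Mp_def)

lemma carrier_Mp: "carrier Mp = preimage_cover SL2_Qp"
  by (simp add: Mp_def)

text \<open>Ensures that products stay in the carrier, whose second components are signs.\<close>

lemma cocycle_sign: "cocycle A B = 1 \<or> cocycle A B = - 1"
proof -
  have h: "hilbert_symbol x y \<in> {1, - 1}" for x y :: "'a padic"
    using hilbert_symbol_range by blast
  have "sigma0 A B \<in> {1, - 1}" "s_p A \<in> {1, - 1}" "s_p B \<in> {1, - 1}" "s_p (A ** B) \<in> {1, - 1}"
    using h by (auto simp: sigma0_def s_p_def)
  then show ?thesis
    by (auto simp: cocycle_def)
qed

lemma SL2_Zp_subset_SL2_Qp: "SL2_Zp \<subseteq> SL2_Qp"
  by (auto simp: SL2_Zp_def)

lemma topspace_Mp: "topspace Mp_topology = (carrier Mp :: ('p::prime_card padic_mat \<times> int) set)"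
proof -
  have "Mp_open (carrier Mp :: ('p padic_mat \<times> int) set)"
    unfolding Mp_open_def
  proof (intro conjI order_refl ballI exI[of _ 0])
    fix x :: "'p padic_mat \<times> int" and k :: "'p padic_mat"
    assume "x \<in> carrier Mp" "k \<in> principal_congruence 0"
    then show "x \<otimes>\<^bsub>Mp\<^esub> (k, 1) \<in> carrier Mp"
      using cocycle_sign[of "fst x" k]
      by (cases x) (auto simp: carrier_Mp preimage_cover_def Mp_mult SL2_Qp_def SL2_Zp_def
          principal_congruence_def det_mul)
  qed
  then show ?thesis
    unfolding topspace_def openin_Mp_topology by (auto simp: Mp_open_def)
qed

text \<open>A cell records the four entries modulo p^m and the sign. If A and B in K are congruent
  modulo p^m, then k = A^-1 B lies in the principal congruence subgroup, and since the cocycle is 1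
  on K, (B, e) = (A, e)(k, 1) lies in the basic neighbourhood of (A, e).\<close>

lemma compactin_SL2_Zp:
  assumes p: "odd CARD('p::prime_card)"
  shows "compactin Mp_topology (preimage_cover (SL2_Zp :: 'p padic_mat set))"
proof (rule compactin_by_refinement)
  let ?r = "padic_residue :: nat \<Rightarrow> 'p padic_int \<Rightarrow> int"
  let ?X = "preimage_cover (SL2_Zp :: 'p padic_mat set)"
  define \<rho> where "\<rho> m x = (?r m (entry (fst x) 1 1), ?r m (entry (fst x) 1 2),
    ?r m (entry (fst x) 2 1), ?r m (entry (fst x) 2 2), snd x)" for m and x :: "'p padic_mat \<times> int"
  show "?X \<subseteq> topspace Mp_topology"
    using SL2_Zp_subset_SL2_Qp by (auto simp: topspace_Mp carrier_Mp preimage_cover_def)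
  show "finite (\<rho> m ` ?X)" for m
  proof (rule finite_subset)
    let ?I = "{0..<int CARD('p) ^ m}"
    show "\<rho> m ` ?X \<subseteq> ?I \<times> ?I \<times> ?I \<times> ?I \<times> {1, - 1}"
      using padic_residue_range[where 'p = 'p and n = m]
      unfolding \<rho>_def preimage_cover_def by fastforce
  qed simp
  show "\<exists>a\<in>?X. \<forall>m. \<rho> m a = \<rho> m (x m)"
    if X: "\<And>m. x m \<in> ?X" and step: "\<And>m. \<rho> m (x (Suc m)) = \<rho> m (x m)" for x
  proof -
    have lim: "\<exists>a :: 'p padic_int. \<forall>m. ?r m a = ?r m (y m)" if "\<And>m. ?r m (y (Suc m)) = ?r m (y m)" for y
      using padic_limit[of y, OF that] by metis
    have "\<exists>a :: 'p padic_int. \<forall>m. ?r m a = ?r m (entry (fst (x m)) i j)" if "i \<in> {1, 2}" "j \<in> {1, 2}" for i j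
      using that step by (intro lim) (auto simp: \<rho>_def)
    then obtain a b c d where lims: "\<And>m. ?r m a = ?r m (entry (fst (x m)) 1 1)"
      "\<And>m. ?r m b = ?r m (entry (fst (x m)) 1 2)" "\<And>m. ?r m c = ?r m (entry (fst (x m)) 2 1)"
      "\<And>m. ?r m d = ?r m (entry (fst (x m)) 2 2)"
      by (metis insertI1 insertI2)
    have sign: "snd (x m) = snd (x 0)" for m
      using step by (induction m) (auto simp: \<rho>_def)
    have "a * d - b * c = 1"
    proof (rule padic_int_eqI)
      fix m
      have "fst (x m) \<in> SL2_Zp"
        using X[of m] by (auto simp: preimage_cover_def)
      from SL2_Zp_entry(2)[OF this] show "?r m (a * d - b * c) = ?r m 1"
        by (metis lims padic_residue_diff padic_residue_mult)
    qed
    then have "(int_mat a b c d, snd (x 0)) \<in> ?X"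
      using X[of 0] by (auto simp: preimage_cover_def int_mat_in_SL2_Zp)
    moreover have "\<rho> m (int_mat a b c d, snd (x 0)) = \<rho> m (x m)" for m
      using lims[of m] sign[of m] by (simp add: \<rho>_def)
    ultimately show ?thesis
      by blast
  qed
  show "\<exists>m. \<forall>y\<in>?X. \<rho> m y = \<rho> m x \<longrightarrow> y \<in> U"
    if U: "openin Mp_topology U" and x: "x \<in> U" "x \<in> ?X" for U x
  proof -
    obtain m where m: "\<And>k. k \<in> principal_congruence m \<Longrightarrow> x \<otimes>\<^bsub>Mp\<^esub> (k, 1) \<in> U"
      using U x unfolding openin_Mp_topology Mp_open_def by blast
    have "y \<in> U" if y: "y \<in> ?X" and eq: "\<rho> m y = \<rho> m x" for y
    proof -
      obtain A e where xA: "x = (A, e)" by fastforce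
      obtain B e' where yB: "y = (B, e')" by fastforce
      have AB: "A \<in> SL2_Zp" "B \<in> SL2_Zp"
        using x y by (auto simp: preimage_cover_def xA yB)
      obtain a b c d where A: "A = int_mat a b c d" and det: "a * d - b * c = 1"
        using AB(1) by (rule SL2_ZpE)
      obtain a' b' c' d' where B: "B = int_mat a' b' c' d'" and det': "a' * d' - b' * c' = 1"
        using AB(2) by (rule SL2_ZpE)
      have e: "e' = e" and cong: "\<pi> ^ m dvd a' - a" "\<pi> ^ m dvd b' - b" "\<pi> ^ m dvd c' - c" "\<pi> ^ m dvd d' - d"
        using eq by (simp_all add: \<rho>_def xA yB A B padic_residue_eq_iff)
      define k where "k = int_mat d (- b) (- c) a ** B"
      have inv: "int_mat d (- b) (- c) a \<in> SL2_Zp"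
        using det by (simp add: int_mat_in_SL2_Zp mult.commute)
      have k_eq: "k = int_mat (d * a' - b * c') (d * b' - b * d') (a * c' - c * a') (a * d' - c * b')"
        by (simp add: k_def B int_mat_mult)
      have kZ: "k \<in> SL2_Zp"
        unfolding k_def using inv AB(2) by (rule SL2_Zp_mult)
      \<comment> \<open>The identity A^-1 B - 1 = A^-1 (B - A), written out entry by entry.\<close>
      have "d * a' - b * c' - 1 = d * (a' - a) - b * (c' - c)" "d * b' - b * d' = d * (b' - b) - b * (d' - d)"
        "a * c' - c * a' = a * (c' - c) - c * (a' - a)" "a * d' - c * b' - 1 = a * (d' - d) - c * (b' - b)"
        using det by (simp_all add: algebra_simps)
      then have "\<pi> ^ m dvd d * a' - b * c' - 1" "\<pi> ^ m dvd d * b' - b * d'"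
        "\<pi> ^ m dvd a * c' - c * a'" "\<pi> ^ m dvd a * d' - c * b' - 1"
        using cong by (metis dvd_diff dvd_mult)+
      with kZ have "k \<in> principal_congruence m"
        unfolding k_eq int_mat_in_SL2_Zp int_mat_in_principal_congruence by blast
      then have "(A, e) \<otimes>\<^bsub>Mp\<^esub> (k, 1) \<in> U"
        using m xA by blast
      moreover have "A ** k = B"
      proof -
        have "A ** int_mat d (- b) (- c) a = mat 1"
          using det by (simp add: A int_mat_mult int_mat_1 mult.commute)
        then show ?thesis
          by (simp add: k_def matrix_mul_assoc)
      qed
      ultimately show ?thesis
        using cocycle_SL2_Zp[OF p AB(1) kZ] by (simp add: Mp_mult yB e)
    qed
    then show ?thesis
      by blast
  qed
qed

section \<open>Quadratic characters\<close>

lemma quadratic_character_padic: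
  fixes \<eta> :: "int \<Rightarrow> complex"
  assumes p: "odd CARD('p::prime_card)" and n: "n \<ge> 1"
    and \<eta>: "quadratic_character (int CARD('p) ^ n) \<eta>"
  defines "\<psi> \<equiv> \<lambda>u :: 'p padic_int. \<eta> (padic_residue n u)"
  shows quadratic_character_mult: "\<And>u v. u dvd 1 \<Longrightarrow> v dvd 1 \<Longrightarrow> \<psi> (u * v) = \<psi> u * \<psi> v"
    and quadratic_character_square: "\<And>u. u dvd 1 \<Longrightarrow> \<psi> u = 1 \<or> \<psi> u = - 1"
    and quadratic_character_cong: "\<And>u v. u dvd 1 \<Longrightarrow> v dvd 1 \<Longrightarrow> \<pi> dvd u - v \<Longrightarrow> \<psi> u = \<psi> v"
proof -
  let ?m = "int CARD('p) ^ n"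
  have m: "?m > 1"
    using int_CARD_gt_1[where 'p = 'p] n by (simp add: one_less_power)
  then interpret residues ?m "residue_ring ?m"
    by unfold_locales
  have unit: "padic_residue n u \<in> carrier (units_of (residue_ring ?m))" if "u dvd 1" for u :: "'p padic_int"
  proof -
    have "padic_residue n u mod int CARD('p) ^ 1 \<noteq> 0"
      using that padic_residue_mod_le[OF n, of u] by (simp add: padic_unit_iff padic_dvd_iff)
    then have "\<not> int CARD('p) dvd padic_residue n u"
      by (simp add: dvd_eq_mod_eq_0)
    then have "coprime (padic_residue n u) ?m"
      using prime_imp_coprime[OF prime_int_CARD[where 'p = 'p]] by (simp add: coprime_commute)
    moreover from this have "padic_residue n u \<noteq> 0"
      using m by auto
    ultimately show ?thesis
      using padic_residue_range[of n u] by (simp add: units_of_def res_units_eq)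
  qed
  have hom: "\<eta> (x * y mod ?m) = \<eta> x * \<eta> y"
    if "x \<in> carrier (units_of (residue_ring ?m))" "y \<in> carrier (units_of (residue_ring ?m))" for x y
  proof -
    have "\<eta> (x \<otimes>\<^bsub>units_of (residue_ring ?m)\<^esub> y) = \<eta> x \<otimes>\<^bsub>complex_units\<^esub> \<eta> y"
      using hom_mult[OF conjunct1[OF \<eta>[unfolded quadratic_character_def]] that] .
    then show ?thesis
      by (simp add: units_of_def residue_ring_def complex_units_def)
  qed
  show mult: "\<psi> (u * v) = \<psi> u * \<psi> v" if "u dvd 1" "v dvd 1" for u v
    using hom[OF unit[OF that(1)] unit[OF that(2)]] by (simp add: \<psi>_def padic_residue_mult)
  show sq: "\<psi> u = 1 \<or> \<psi> u = - 1" if "u dvd 1" for u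
    using \<eta> unit[OF that] unfolding quadratic_character_def \<psi>_def by (simp add: power2_eq_1_iff)
  have one: "\<psi> 1 = 1"
    using mult[of 1 1] sq[of 1] by auto
  show "\<psi> u = \<psi> v" if uv: "u dvd 1" "v dvd 1" "\<pi> dvd u - v" for u v
  proof -
    \<comment> \<open>\<open>u / v\<close> lies in the pro-\<open>p\<close> group \<open>1 + p\<int>\<^sub>p\<close>, which has no character of order two as \<open>p\<close> is odd.\<close>
    obtain v' where v': "v * v' = 1"
      using uv(2) by (metis dvdE)
    then have v'_unit: "v' dvd 1"
      by (metis dvd_triv_right)
    define w where "w = u * v'"
    have w: "w dvd 1"
      using mult_dvd_mono[OF uv(1) v'_unit] by (simp add: w_def)
    have "w - 1 = (u - v) * v'"
      using v' by (simp add: w_def algebra_simps)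
    \<comment> \<open>The p^n-th power of w is 1 modulo p^n, the modulus of \<eta>, so an odd power
      of the sign \<psi>(w) equals 1.\<close>
    then have "\<pi> ^ Suc n dvd w ^ (CARD('p) ^ n) - 1"
      using uv(3) by (intro padic_power_one_plus) simp
    then have "\<pi> ^ n dvd w ^ (CARD('p) ^ n) - 1"
      using dvd_trans[OF le_imp_power_dvd[of n "Suc n"]] by simp
    then have "\<psi> (w ^ (CARD('p) ^ n)) = 1"
      using one padic_residue_eq_iff[of n "w ^ (CARD('p) ^ n)" 1] by (simp add: \<psi>_def)
    moreover have "\<psi> (w ^ k) = \<psi> w ^ k" for k
    proof (induction k)
      case (Suc k)
      have "w ^ k dvd 1"
        using w by (metis dvd_power_same power_one)
      with Suc w show ?case by (simp add: mult)
    qed (simp add: one)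
    ultimately have "\<psi> w ^ (CARD('p) ^ n) = 1"
      by simp
    then have "\<psi> w = 1"
      using sq[OF w] p by auto
    moreover have "u = w * v"
      using v' by (simp add: w_def mult_ac)
    ultimately show ?thesis
      using mult[OF w uv(2)] by simp
  qed
qed

section \<open>Functions supported on one double coset\<close>

lemma int_mat_in_K0:
  fixes a b c d :: "'p::prime_card padic_int"
  shows "int_mat a b c d \<in> K0 n \<longleftrightarrow> a * d - b * c = 1 \<and> \<pi> ^ n dvd c"
  by (simp only: K0_def mem_Collect_eq int_mat_in_SL2_Zp int_mat_nth to_fract_eq_iff dvd_def)

lemma K0_subset_SL2_Zp: "K0 n \<subseteq> SL2_Zp"
  by (auto simp: K0_def)

lemma K0E:
  fixes A :: "'p::prime_card padic_mat"
  assumes "A \<in> K0 n"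
  obtains a b c d where "A = int_mat a b c d" "a * d - b * c = 1" "\<pi> ^ n dvd c"
  using assms K0_subset_SL2_Zp by (metis SL2_ZpE int_mat_in_K0 subsetD)

text \<open>At level 0 the group lemmas on \<open>K0\<close> become statements about K.\<close>

lemma K0_0: "K0 0 = SL2_Zp"
  using K0_subset_SL2_Zp by (fastforce elim: SL2_ZpE simp: int_mat_in_K0)

lemma K0_mult: "A \<in> K0 n \<Longrightarrow> B \<in> K0 n \<Longrightarrow> A ** B \<in> K0 n"
  for A B :: "'p::prime_card padic_mat"
proof (elim K0E)
  fix a b c d a' b' c' d' :: "'p padic_int"
  assume *: "A = int_mat a b c d" "B = int_mat a' b' c' d'"
    "a * d - b * c = 1" "a' * d' - b' * c' = 1" "\<pi> ^ n dvd c" "\<pi> ^ n dvd c'"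
  then have "A ** B \<in> SL2_Zp"
    by (simp add: SL2_Zp_mult int_mat_in_SL2_Zp)
  with * show "A ** B \<in> K0 n"
    by (simp add: int_mat_mult int_mat_in_K0 int_mat_in_SL2_Zp)
qed

lemma K0_one: "mat 1 \<in> K0 n"
  by (simp add: int_mat_1 int_mat_in_K0)

lemma K0_inverse:
  fixes A :: "'p::prime_card padic_mat"
  assumes "A \<in> K0 n"
  obtains B where "B \<in> K0 n" "A ** B = mat 1" "B ** A = mat 1"
proof -
  obtain a b c d where *: "A = int_mat a b c d" "a * d - b * c = 1" "\<pi> ^ n dvd c"
    using assms by (rule K0E)
  then show ?thesis
    by (intro that[of "int_mat d (- b) (- c) a"])
      (simp_all add: int_mat_in_K0 int_mat_mult int_mat_1 algebra_simps)
qed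

lemma SL2_Zp_K0_conj_iff:
  assumes "k \<in> K0 n" "k' \<in> K0 n"
  shows "k ** A ** k' \<in> SL2_Zp \<longleftrightarrow> A \<in> SL2_Zp"
proof
  have k: "k \<in> K0 0" "k' \<in> K0 0"
    using assms K0_subset_SL2_Zp by (auto simp: K0_0)
  obtain l where l: "l \<in> K0 0" "l ** k = mat 1"
    using k(1) by (rule K0_inverse)
  obtain l' where l': "l' \<in> K0 0" "k' ** l' = mat 1"
    using k(2) by (rule K0_inverse)
  have "A = l ** (k ** A ** k') ** l'"
    using l l' by (metis matrix_mul_assoc matrix_mul_lid matrix_mul_rid)
  then show "A \<in> SL2_Zp" if "k ** A ** k' \<in> SL2_Zp"
    using that l l' K0_mult unfolding K0_0[symmetric] by metis
  show "k ** A ** k' \<in> SL2_Zp" if "A \<in> SL2_Zp"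
    using that k K0_mult unfolding K0_0[symmetric] by metis
qed

text \<open>The equivalence settles equivariance off the double coset as well: both sides are 0
  there.\<close>

lemma K0_coset_conj_iff:
  fixes g A :: "'p::prime_card padic_mat"
  assumes "k \<in> K0 n" "k' \<in> K0 n"
  defines "X \<equiv> {k ** g ** k' | k k'. k \<in> K0 n \<and> k' \<in> K0 n}"
  shows "k ** A ** k' \<in> X \<longleftrightarrow> A \<in> X"
proof
  obtain l where l: "l \<in> K0 n" "l ** k = mat 1"
    using assms(1) by (rule K0_inverse)
  obtain l' where l': "l' \<in> K0 n" "k' ** l' = mat 1"
    using assms(2) by (rule K0_inverse)
  have X: "m ** B ** m' \<in> X" if "m \<in> K0 n" "m' \<in> K0 n" "B \<in> X" for m m' B
  proof -
    from that(3) obtain h h' where "h \<in> K0 n" "h' \<in> K0 n" "B = h ** g ** h'"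
      unfolding X_def by blast
    moreover from this have "m ** B ** m' = (m ** h) ** g ** (h' ** m')"
      by (simp add: matrix_mul_assoc)
    ultimately show ?thesis
      unfolding X_def using that K0_mult by blast
  qed
  have "A = l ** (k ** A ** k') ** l'"
    using l l' by (metis matrix_mul_assoc matrix_mul_lid matrix_mul_rid)
  then show "A \<in> X" if "k ** A ** k' \<in> X"
    using X[OF l(1) l'(1) that] by simp
  show "k ** A ** k' \<in> X" if "A \<in> X"
    using X assms(1,2) that by blast
qed

lemma K0_char_entry: "K0_char n \<eta> A = \<eta> (padic_residue n (entry A 2 2))"
  by (simp add: K0_char_def entry_def)

text \<open>The function (A, e) to e \<theta>(A) is extended by zero. It is invariant under right
  translation by the principal congruence subgroup of level n, hence continuous into a discrete
  space; its support is therefore closed, and compact as a subset of the preimage of K. The complex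
  conjugates in \<open>Hecke_K\<close> disappear because \<eta> takes signs as values on
  units.\<close>

lemma Hecke_K_double_coset_exists:
  fixes g :: "'p::prime_card padic_mat" and \<theta> :: "'p padic_mat \<Rightarrow> complex"
  assumes p: "odd CARD('p)" and n: "n \<ge> 1" and \<eta>: "quadratic_character (int CARD('p) ^ n) \<eta>"
    and g: "g \<in> SL2_Zp"
  defines "X \<equiv> {k ** g ** k' | k k'. k \<in> K0 n \<and> k' \<in> K0 n}"
  assumes nonzero: "\<theta> g \<noteq> 0"
    and equivariant: "\<And>k k' A. k \<in> K0 n \<Longrightarrow> k' \<in> K0 n \<Longrightarrow> A \<in> X
      \<Longrightarrow> \<theta> (k ** A ** k') = K0_char n \<eta> k * K0_char n \<eta> k' * \<theta> A"
  shows "\<exists>f \<in> Hecke_K n \<eta>. f \<noteq> (\<lambda>_. 0) \<and> {x. f x \<noteq> 0} \<subseteq> K0_double_coset n (g, 1)"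
proof -
  \<comment> \<open>The guard on e makes f vanish outside the carrier, since the support condition
    ranges over all pairs.\<close>
  define f where "f = (\<lambda>(A, e). if A \<in> X \<and> (e = 1 \<or> e = - 1) then of_int e * \<theta> A else 0)"
  have XZ: "X \<subseteq> SL2_Zp"
    using g SL2_Zp_K0_conj_iff by (auto simp: X_def)
  have conj_iff: "k ** A ** k' \<in> X \<longleftrightarrow> A \<in> X" if "k \<in> K0 n" "k' \<in> K0 n" for k k' A
    unfolding X_def by (rule K0_coset_conj_iff[OF that])
  have gX: "g \<in> X"
    using K0_one unfolding X_def by (metis (mono_tags, lifting) matrix_mul_lid matrix_mul_rid mem_Collect_eq)
  have sign: "K0_char n \<eta> k = 1 \<or> K0_char n \<eta> k = - 1" if "k \<in> K0 n" for k :: "'p padic_mat"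
  proof -
    obtain a b c d where *: "k = int_mat a b c d" "a * d - b * c = 1" "\<pi> ^ n dvd c"
      using \<open>k \<in> K0 n\<close> by (rule K0E)
    then have "\<pi> dvd c"
      using n dvd_trans[OF dvd_power] by auto
    then have "d dvd 1"
      using unit_diagonal[OF *(2)] by blast
    then show ?thesis
      using quadratic_character_square[OF p n \<eta>] by (simp add: K0_char_entry *)
  qed
  have in_K0: "k \<in> K0 n" and char_1: "K0_char n \<eta> k = 1"
    if k: "k \<in> principal_congruence n" for k :: "'p padic_mat"
  proof -
    have "k \<in> SL2_Zp"
      using k by (simp add: principal_congruence_def)
    then obtain a b c d where *: "k = int_mat a b c d" "a * d - b * c = 1"
      by (rule SL2_ZpE)
    then have **: "\<pi> ^ n dvd c" "\<pi> ^ n dvd d - 1"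
      using k by (simp_all add: int_mat_in_principal_congruence)
    then show "k \<in> K0 n"
      using * by (simp add: int_mat_in_K0)
    have "K0_char n \<eta> k = K0_char n \<eta> (mat 1 :: 'p padic_mat)"
      using ** by (simp add: K0_char_entry * int_mat_1 padic_residue_eq_iff[symmetric])
    \<comment> \<open>A sign equal to its own square is 1.\<close>
    moreover have "K0_char n \<eta> (mat 1 :: 'p padic_mat)
        = K0_char n \<eta> (mat 1 :: 'p padic_mat) * K0_char n \<eta> (mat 1 :: 'p padic_mat)"
      using quadratic_character_mult[OF p n \<eta>, of 1 1] by (simp add: K0_char_entry int_mat_1)
    ultimately show "K0_char n \<eta> k = 1"
      using sign[OF K0_one] by auto
  qed
  have loc_const: "f (x \<otimes>\<^bsub>Mp\<^esub> (k, 1)) = f x" if "x \<in> carrier Mp" "k \<in> principal_congruence n" for x k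
  proof -
    obtain A e where x: "x = (A, e)" by fastforce
    have k: "k \<in> K0 n" and kZ: "k \<in> SL2_Zp"
      using in_K0[OF that(2)] K0_subset_SL2_Zp by auto
    have iff: "A ** k \<in> X \<longleftrightarrow> A \<in> X"
      using conj_iff[OF K0_one k, of A] by simp
    show ?thesis
    proof (cases "A \<in> X")
      case True
      then have "cocycle A k = 1"
        using XZ cocycle_SL2_Zp[OF p _ kZ] by blast
      moreover have "\<theta> (A ** k) = \<theta> A"
        using equivariant[OF K0_one k True] char_1[OF that(2)]
          char_1[of "mat 1", unfolded int_mat_1 int_mat_in_principal_congruence]
        by (simp flip: int_mat_1)
      ultimately show ?thesis
        using True iff by (simp add: x f_def Mp_mult)
    next
      case False
      then show ?thesis
        using iff by (simp add: x f_def Mp_mult)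
    qed
  qed
  have cont: "continuous_map Mp_topology (discrete_topology UNIV) f"
    unfolding continuous_map_def
  proof (intro conjI allI impI)
    fix U
    show "openin Mp_topology {x \<in> topspace Mp_topology. f x \<in> U}"
      unfolding openin_Mp_topology Mp_open_def topspace_Mp
    proof (intro conjI ballI exI[of _ n])
      fix x k
      assume x: "x \<in> {x \<in> carrier Mp. f x \<in> U}" and k: "(k :: 'p padic_mat) \<in> principal_congruence n"
      have "k \<in> SL2_Qp"
        using k by (simp add: principal_congruence_def SL2_Zp_def)
      then have "x \<otimes>\<^bsub>Mp\<^esub> (k, 1) \<in> carrier Mp"
        using x cocycle_sign[of "fst x" k]
        by (cases x) (auto simp: carrier_Mp preimage_cover_def Mp_mult SL2_Qp_def det_mul)
      then show "x \<otimes>\<^bsub>Mp\<^esub> (k, 1) \<in> {x \<in> carrier Mp. f x \<in> U}"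
        using x k loc_const by auto
    qed blast
  qed simp
  have supp: "{x. f x \<noteq> 0} \<subseteq> preimage_cover SL2_Zp"
    using XZ by (auto simp: f_def preimage_cover_def split: if_splits)
  have "compactin Mp_topology (Mp_topology closure_of {x \<in> carrier Mp. f x \<noteq> 0})"
  proof -
    let ?S = "{x \<in> carrier Mp. f x \<noteq> 0}"
    have "closedin Mp_topology {x \<in> topspace Mp_topology. f x \<in> - {0}}"
      using closedin_continuous_map_preimage[OF cont, of "- {0}"] by simp
    then have "closedin Mp_topology ?S"
      by (simp add: topspace_Mp)
    moreover have "?S \<subseteq> preimage_cover SL2_Zp"
      using supp by blast
    ultimately have "compactin Mp_topology ?S"
      using closed_compactin[OF compactin_SL2_Zp[OF p]] by blast
    then show ?thesis
      using \<open>closedin Mp_topology ?S\<close> by (simp add: closure_of_closedin)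
  qed
  with cont have "f \<in> Cc_infinity"
    by (simp add: Cc_infinity_def)
  moreover have "f (k \<otimes>\<^bsub>Mp\<^esub> x \<otimes>\<^bsub>Mp\<^esub> k') = cnj (genuine_char n \<eta> k) * cnj (genuine_char n \<eta> k') * f x"
    if k: "k \<in> preimage_cover (K0 n)" "k' \<in> preimage_cover (K0 n)" and x: "x \<in> carrier Mp" for k k' x
  proof -
    obtain h e h' e' A d where eqs: "k = (h, e)" "k' = (h', e')" "x = (A, d)"
      by (metis surj_pair)
    have h: "h \<in> K0 n" "h' \<in> K0 n" and e: "e = 1 \<or> e = - 1" "e' = 1 \<or> e' = - 1" "d = 1 \<or> d = - 1"
      using k x by (auto simp: eqs preimage_cover_def carrier_Mp)
    show ?thesis
    proof (cases "A \<in> X")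
      case True
      have Z: "A \<in> SL2_Zp" "h \<in> SL2_Zp" "h' \<in> SL2_Zp"
        using True XZ h K0_subset_SL2_Zp by auto
      have "k \<otimes>\<^bsub>Mp\<^esub> x \<otimes>\<^bsub>Mp\<^esub> k' = (h ** A ** h', e * d * e')"
        using Z by (simp add: eqs Mp_mult cocycle_SL2_Zp[OF p] SL2_Zp_mult)
      then have "f (k \<otimes>\<^bsub>Mp\<^esub> x \<otimes>\<^bsub>Mp\<^esub> k') = of_int (e * d * e') * (K0_char n \<eta> h * K0_char n \<eta> h' * \<theta> A)"
        using conj_iff[OF h] True equivariant[OF h True] e by (auto simp: f_def)
      moreover have "cnj (K0_char n \<eta> h) = K0_char n \<eta> h" "cnj (K0_char n \<eta> h') = K0_char n \<eta> h'"
        using sign[OF h(1)] sign[OF h(2)] by auto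
      ultimately show ?thesis
        using True e by (simp add: eqs f_def genuine_char_def)
    next
      case False
      then show ?thesis
        using conj_iff[OF h, of A] by (simp add: eqs Mp_mult f_def)
    qed
  qed
  ultimately have "f \<in> Hecke_K n \<eta>"
    using supp by (simp add: Hecke_K_def)
  moreover have "f (g, 1) \<noteq> 0"
    using gX nonzero by (simp add: f_def)
  then have "f \<noteq> (\<lambda>_. 0)"
    by auto
  moreover have "{x. f x \<noteq> 0} \<subseteq> K0_double_coset n (g, 1)"
  proof
    fix x assume "x \<in> {x. f x \<noteq> 0}"
    then obtain A e where x: "x = (A, e)" and A: "A \<in> X" and e: "e = 1 \<or> e = - 1"
      by (cases x) (auto simp: f_def split: if_splits)
    obtain k k' where k: "k \<in> K0 n" "k' \<in> K0 n" "A = k ** g ** k'"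
      using A unfolding X_def by blast
    then have Z: "k \<in> SL2_Zp" "k' \<in> SL2_Zp"
      using K0_subset_SL2_Zp by auto
    \<comment> \<open>The sign e is absorbed into the left factor, as the full preimage contains
      both lifts of k.\<close>
    have "x = (k, e) \<otimes>\<^bsub>Mp\<^esub> (g, 1) \<otimes>\<^bsub>Mp\<^esub> (k', 1)"
      using Z g by (simp add: x k(3) Mp_mult cocycle_SL2_Zp[OF p] SL2_Zp_mult)
    moreover have "(k, e) \<in> preimage_cover (K0 n)" "(k', 1) \<in> preimage_cover (K0 n)"
      using k e by (auto simp: preimage_cover_def)
    ultimately show "x \<in> K0_double_coset n (g, 1)"
      unfolding K0_double_coset_def set_mult_def r_coset_def by blast
  qed
  ultimately show ?thesis
    by blast
qed

lemma K0_antimono: "m \<le> n \<Longrightarrow> K0 n \<subseteq> (K0 m :: 'p::prime_card padic_mat set)"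
proof
  fix A :: "'p padic_mat"
  assume "m \<le> n" "A \<in> K0 n"
  then show "A \<in> K0 m"
    by (elim K0E) (simp add: int_mat_in_K0 power_le_dvd)
qed

lemma K0_1E:
  fixes A :: "'p::prime_card padic_mat"
  assumes "A \<in> K0 1"
  obtains a b c d where "A = int_mat a b c d" "a * d - b * c = 1" "\<pi> dvd c" "a dvd 1" "d dvd 1"
proof -
  obtain a b c d where "A = int_mat a b c d" "a * d - b * c = 1" "\<pi> dvd c"
    using assms by (rule K0E) simp
  with that show ?thesis
    using unit_diagonal by blast
qed

section \<open>The two explicit equivariant functions\<close>

context
  fixes n :: nat and \<eta> :: "int \<Rightarrow> complex" and \<psi> :: "'p::prime_card padic_int \<Rightarrow> complex"
  assumes p: "odd CARD('p)" and n: "n \<ge> 1" and \<eta>: "quadratic_character (int CARD('p) ^ n) \<eta>"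
  defines "\<psi> \<equiv> \<lambda>u. \<eta> (padic_residue n u)"
begin

lemma character_mult: "u dvd 1 \<Longrightarrow> v dvd 1 \<Longrightarrow> \<psi> (u * v) = \<psi> u * \<psi> v"
  unfolding \<psi>_def by (rule quadratic_character_mult[OF p n \<eta>])

lemma character_sign: "u dvd 1 \<Longrightarrow> \<psi> u = 1 \<or> \<psi> u = - 1"
  unfolding \<psi>_def by (rule quadratic_character_square[OF p n \<eta>])

text \<open>The unit conclusion comes along so that the congruence can be applied again to the
  result.\<close>

lemma character_mult_cong:
  assumes "u dvd 1" "v dvd 1" "\<pi> dvd w - u * v"
  shows "\<psi> w = \<psi> u * \<psi> v" and "w dvd 1"
proof -
  have uv: "u * v dvd 1"
    using mult_dvd_mono[OF assms(1,2)] by simp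
  then show w: "w dvd 1"
    using uniformizer_dvd_diff_cong[OF assms(3)] by (simp add: padic_unit_iff)
  have "\<psi> w = \<psi> (u * v)"
    unfolding \<psi>_def using quadratic_character_cong[OF p n \<eta> w uv assms(3)] .
  then show "\<psi> w = \<psi> u * \<psi> v"
    using character_mult[OF assms(1,2)] by simp
qed

lemma Hecke_K_lower_unipotent:
  fixes s :: "'p padic_int"
  assumes s: "\<pi> dvd s"
  shows "\<exists>f \<in> Hecke_K n \<eta>. f \<noteq> (\<lambda>_. 0) \<and> {x. f x \<noteq> 0} \<subseteq> K0_double_coset n (int_mat 1 0 s 1, 1)"
proof (rule Hecke_K_double_coset_exists[where \<theta> = "\<lambda>A. \<psi> (entry A 2 2)", OF p n \<eta>])
  show "int_mat 1 0 s 1 \<in> SL2_Zp"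
    by (simp add: int_mat_in_SL2_Zp)
  show "\<psi> (entry (int_mat 1 0 s 1) 2 2) \<noteq> 0"
    using character_sign[of 1] by auto
  \<comment> \<open>In \<open>K0 1\<close> the lower left entries vanish modulo p, so the lower
    right entry is a homomorphism modulo p. This group contains the whole double coset.\<close>
  have mult: "\<psi> (entry (A ** B) 2 2) = \<psi> (entry A 2 2) * \<psi> (entry B 2 2)"
    if "A \<in> K0 1" "B \<in> K0 1" for A B :: "'p padic_mat"
    using that by (elim K0_1E) (auto simp: int_mat_mult intro!: character_mult_cong(1))
  fix k k' A :: "'p padic_mat"
  assume k: "k \<in> K0 n" "k' \<in> K0 n"
    and "A \<in> {k ** int_mat 1 0 s 1 ** k' |k k'. k \<in> K0 n \<and> k' \<in> K0 n}"
  moreover have "int_mat 1 0 s 1 \<in> K0 1"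
    using s by (simp add: int_mat_in_K0)
  ultimately have "A \<in> K0 1" "k \<in> K0 1" "k' \<in> K0 1"
    using K0_antimono[OF n] by (auto intro!: K0_mult)
  then show "\<psi> (entry (k ** A ** k') 2 2) = K0_char n \<eta> k * K0_char n \<eta> k' * \<psi> (entry A 2 2)"
    by (simp add: mult K0_mult) (simp add: K0_char_entry \<psi>_def)
qed

text \<open>Modulo p the lower left entry of k A k' is d z a', with d from k, z from A and a' from
  k'. As a' d' is 1 modulo p, a' may be replaced by d' under a sign character.\<close>

lemma Hecke_K_weyl:
  "\<exists>f \<in> Hecke_K n \<eta>. f \<noteq> (\<lambda>_. 0) \<and> {x. f x \<noteq> 0} \<subseteq> K0_double_coset n (int_mat 0 1 (- 1) 0 :: 'p padic_mat, 1)"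
proof (rule Hecke_K_double_coset_exists[where \<theta> = "\<lambda>A. \<psi> (entry A 2 1)", OF p n \<eta>])
  let ?w = "int_mat 0 1 (- 1) 0 :: 'p padic_mat"
  show "?w \<in> SL2_Zp"
    by (simp add: int_mat_in_SL2_Zp)
  show "\<psi> (entry ?w 2 1) \<noteq> 0"
    using character_sign[of "- 1"] by auto
  \<comment> \<open>This set contains w(1) and is stable under \<open>K0 1\<close> on both sides, so
    the particular factorisation of A does not enter.\<close>
  define Y where "Y = {A :: 'p padic_mat. A \<in> SL2_Zp \<and> entry A 2 1 dvd 1}"
  have equiv: "k ** A ** k' \<in> Y \<and> \<psi> (entry (k ** A ** k') 2 1) = \<psi> (entry k 2 2) * \<psi> (entry k' 2 2) * \<psi> (entry A 2 1)"
    if kA: "k \<in> K0 1" "k' \<in> K0 1" "A \<in> Y" for k k' A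
  proof -
    obtain a b c d where k: "k = int_mat a b c d" "a * d - b * c = 1" "\<pi> dvd c" "d dvd 1"
      using kA(1) by (rule K0_1E)
    obtain a' b' c' d' where k': "k' = int_mat a' b' c' d'" "a' * d' - b' * c' = 1" "\<pi> dvd c'" "a' dvd 1" "d' dvd 1"
      using kA(2) by (rule K0_1E)
    obtain x y z t where A: "A = int_mat x y z t" "z dvd 1"
      using kA(3) unfolding Y_def by (auto elim: SL2_ZpE)
    have "\<pi> dvd 1 - a' * d'"
    proof -
      have "a' * d' = 1 + b' * c'"
        using k'(2) by (simp add: diff_eq_eq)
      then show ?thesis
        using k'(3) by simp
    qed
    then have "\<psi> 1 = \<psi> a' * \<psi> d'"
      by (rule character_mult_cong(1)[OF k'(4,5)])
    moreover have "\<psi> 1 = \<psi> 1 * \<psi> 1"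
      using character_mult[of 1 1] by simp
    ultimately have a': "\<psi> a' = \<psi> d'"
      using character_sign[OF k'(4)] character_sign[OF k'(5)] by auto
    \<comment> \<open>The lower left entry of k A; \<open>z2\<close> is that of k A k'. Each step
      drops a multiple of p.\<close>
    define z1 where "z1 = c * x + d * z"
    have "\<pi> dvd z1 - d * z"
      using k(3) by (simp add: z1_def)
    then have z1: "\<psi> z1 = \<psi> d * \<psi> z" "z1 dvd 1"
      using character_mult_cong[OF k(4) A(2)] by blast+
    define z2 where "z2 = z1 * a' + (c * y + d * t) * c'"
    have "\<pi> dvd z2 - z1 * a'"
      using k'(3) by (simp add: z2_def)
    then have z2: "\<psi> z2 = \<psi> z1 * \<psi> a'" "z2 dvd 1"
      using character_mult_cong[OF z1(2) k'(4)] by blast+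
    have "entry (k ** A ** k') 2 1 = z2"
      by (simp add: k k' A int_mat_mult z2_def z1_def)
    moreover have "k ** A ** k' \<in> SL2_Zp"
      using kA K0_subset_SL2_Zp by (auto simp: Y_def intro!: SL2_Zp_mult)
    ultimately show ?thesis
      using z1 z2 a' by (simp add: Y_def k k' A mult_ac)
  qed
  fix k k' A :: "'p padic_mat"
  assume k: "k \<in> K0 n" "k' \<in> K0 n" and A: "A \<in> {k ** ?w ** k' |k k'. k \<in> K0 n \<and> k' \<in> K0 n}"
  have "?w \<in> Y"
    by (simp add: Y_def int_mat_in_SL2_Zp)
  then have "A \<in> Y"
    using A equiv K0_antimono[OF n] by blast
  then show "\<psi> (entry (k ** A ** k') 2 1) = K0_char n \<eta> k * K0_char n \<eta> k' * \<psi> (entry A 2 1)"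
    using equiv[of k k' A] k K0_antimono[OF n] by (auto simp: K0_char_entry \<psi>_def)
qed

end

lemma y_mat_eq: "y_mat (to_fract s) = int_mat 1 0 s 1"
  by (rule int_mat_eqI) (simp_all add: y_mat_def)

lemma w_mat_eq: "w_mat 1 = int_mat 0 1 (- 1) 0"
  by (rule int_mat_eqI) (simp_all add: w_mat_def)

theorem proposition2p2:
  fixes n :: nat
    and \<eta> :: "int \<Rightarrow> complex"
    and lam :: "'p::prime_card padic_int"
    and g :: "'p padic_mat \<times> int"
  assumes "odd CARD('p)"
    and "n \<ge> 2"
    and "quadratic_character (int CARD('p) ^ n) \<eta>"
    and "lam dvd 1"
    and "\<not> QuadRes (int CARD('p)) (padic_residue 1 lam)"
    and "g \<in> {(mat 1, 1), (w_mat 1, 1)} \<union>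
           (\<Union>r\<in>{1..n - 1}. {(y_mat (of_nat CARD('p) ^ r), 1),
                             (y_mat (padic_of_int lam * of_nat CARD('p) ^ r), 1)})"
  shows "\<exists>f \<in> Hecke_K n \<eta>. f \<noteq> (\<lambda>_. 0) \<and> {x. f x \<noteq> 0} \<subseteq> K0_double_coset n g"
proof -
  have n: "n \<ge> 1"
    using assms(2) by simp
  have dvd: "\<pi> dvd v * (\<pi> :: 'p padic_int) ^ r" if "r \<ge> 1" for r v
    using that by (simp add: dvd_power)
  have y: "y_mat (to_fract v * of_nat CARD('p) ^ r) = int_mat 1 0 (v * \<pi> ^ r) 1" for v :: "'p padic_int" and r
    by (simp add: to_fract_power to_fract_of_nat flip: y_mat_eq)
  \<comment> \<open>The identity is s = 0, and r \<ge> 1 makes s divisible by p in both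
    families.\<close>
  have "g = (int_mat 0 1 (- 1) 0, 1) \<or> (\<exists>s. \<pi> dvd s \<and> g = (int_mat 1 0 s 1, 1))"
    using assms(6)
  proof (elim UnE UN_E insertE emptyE)
    fix r
    assume r: "r \<in> {1..n - 1}"
    show ?thesis if "g = (y_mat (of_nat CARD('p) ^ r), 1)"
      using that y[of 1 r] dvd[of r 1] r by (intro disjI2 exI[of _ "1 * \<pi> ^ r"]) simp
    show ?thesis if "g = (y_mat (padic_of_int lam * of_nat CARD('p) ^ r), 1)"
      using that y[of lam r] dvd[of r lam] r by (intro disjI2 exI[of _ "lam * \<pi> ^ r"]) simp
  qed (auto simp: int_mat_1 w_mat_eq)
  then show ?thesis
    using Hecke_K_weyl[OF assms(1) n assms(3)] Hecke_K_lower_unipotent[OF assms(1) n assms(3)] by auto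
qed

end
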